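(* Consider the stochastic first-order method described in the context with proximal function $\phi(\mathbf z)=\frac{\hat\rho}{2}\|\mathbf z\|_1^2$, $\hat\rho>3/2$, minibatch gradient estimates $G^k=\frac1{m_k}\sum_{i=1}^{m_k}G(\mathbf x^k,\zeta_i^k)$, and output probabilities $p_k=\eta_k/\sum_{j=1}^K\eta_j$, and suppose that the assumptions (i)–(iv) in the context hold. Let $$\eta_k\equiv\frac1L,\qquad K=\left\lceil\frac{\Delta_fL}{\epsilon^2}\right\rceil,\qquad m_k\equiv m=\left\lceil\frac{e^2(\log d)\sigma_\infty^2}{\epsilon^2}\right\rceil .$$ Then $$\mathbb E\big[\mathrm{dist}_{\|\cdot\|_\infty}(0,\partial(f+\delta_X)(\mathbf x^{Y+1}))\big]\le C_1(\hat\rho)\,\epsilon,$$ where $C_1(\hat\rho)$ is a constant depending only on $\hat\rho$. As a result, the sample complexity of the algorithm is $$Km=\left\lceil\frac{\Delta_fL}{\epsilon^2}\right\rceil\left\lceil\frac{e^2(\log d)\sigma_\infty^2}{\epsilon^2}\right\rceil=\mathcal O\left(\frac{\Delta_fL(\log d)\sigma_\infty^2}{\epsilon^4}\right).$$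
   Context: Problem: minimize $f(\mathbf x)=\mathbb E[F(\mathbf x,\zeta)]$ over $\mathbf x\in X$, where $X\subseteq\mathbb R^d$ is closed and convex, $\zeta$ is a random vector with values in $\Xi$, the expectation is well defined and finite for every $\mathbf x\in\mathbb R^d$, and $f$ is everywhere differentiable and possibly nonconvex. I.i.d. realizations of $\zeta$ can be generated, and there is a deterministic measurable $G:X\times\Xi\to\mathbb R^d$ with $\mathbb E[G(\mathbf x,\zeta)]=\nabla f(\mathbf x)$ for all $\mathbf x\in X$. $\|\cdot\|$ is the Euclidean norm. Assumptions: (i) a stochastic first-order oracle is available, i.e. $G(\mathbf x,\zeta)$ can be efficiently evaluated for any given $(\mathbf x,\zeta)$; (ii) $\sigma_\infty^2=\max_{\mathbf x\in X}\mathbb E[\|G(\mathbf x,\zeta)-\nabla f(\mathbf x)\|_\infty^2]<\infty$; (iii) for some constant $L\ge0$, $\|\nabla f(\mathbf x)-\nabla f(\mathbf y)\|_\infty\le L\|\mathbf x-\mathbf y\|_1$ for all $\mathbf x,\mathbf y\in X$; (iv) for some $\underline f\in\mathbb R$, $f(\mathbf x)\ge\underline f$ for all $\mathbf x\in X$. Set $\Delta_f=\mathbb E[f(\mathbf x^1)]-\underline f$. The number $\epsilon>0$ is the target accuracy. Algorithm: choose $\mathbf x^1\in X$, $K$, and stepsizes $\eta_k>0$. For $k=1,\dots,K$: generate the gradient estimate $G^k$ and set $$\mathbf x^{k+1}=\arg\min_{\mathbf x\in X}\left\{\tfrac12\|\mathbf x-(\mathbf x^k-\eta_kG^k)\|^2+\phi(\mathbf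 x-\mathbf x^k)\right\}.$$ Output $\mathbf x^{Y+1}$ for a randomly drawn index $Y$ (independent of the iterates) with $\mathbb P[Y=k]=p_k$, $k=1,\dots,K$. In the minibatch estimate the $\zeta_i^k$ are i.i.d. realizations of $\zeta$, drawn afresh at each iteration. (The setting also fixes an auxiliary sequence $t_k=3\eta_k/\hat\rho$, used only in the analysis; it enters neither the algorithm nor the conclusion.) The sample complexity is the total number of samples of $\zeta$ used. Notation: $\delta_X$ is the indicator function of $X$ ($0$ on $X$, $+\infty$ off $X$), $\partial$ is the Fréchet subdifferential, and $\mathrm{dist}_{\|\cdot\|_\infty}(0,S)=\inf\{\|\mathbf v\|_\infty:\mathbf v\in S\}$. *)

theory Defs
  imports "HOL-Probability.Probability" "HOL-Library.Landau_Symbols"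
begin

text \<open>
  The space of decision variables is \<open>real ^ 'n\<close>, its dimension is \<open>CARD('n)\<close>. The Euclidean
  norm is \<^const>\<open>norm\<close> and the maximum norm is \<^const>\<open>infnorm\<close>.
\<close>

definition l1norm :: "real ^ 'n \<Rightarrow> real" where
  "l1norm x = (\<Sum>i\<in>UNIV. \<bar>x $ i\<bar>)"

definition set_ind :: "'a set \<Rightarrow> 'a \<Rightarrow> ereal" where
  "set_ind X x = (if x \<in> X then 0 else \<infinity>)"

text \<open>
  The Frechet subdifferential of an extended real valued function; it is empty at points where
  the function is not finite.
\<close>

definition frechet_subdiff :: "('a :: real_inner \<Rightarrow> ereal) \<Rightarrow> 'a \<Rightarrow> 'a set" where
  "frechet_subdiff h x =
     {v. \<bar>h x\<bar> \<noteq> \<infinity> \<and>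
         0 \<le> Liminf (at x) (\<lambda>y. (h y - h x - ereal (v \<bullet> (y - x))) / ereal (norm (y - x)))}"

text \<open>Taking the infimum in \<^typ>\<open>ennreal\<close> makes the distance to the empty set infinite.\<close>

definition dist0_inf :: "'a :: euclidean_space set \<Rightarrow> ennreal" where
  "dist0_inf S = (INF v\<in>S. ennreal (infnorm v))"

text \<open>
  One step of the method with proximal function \<open>\<phi>\<close>, stepsize \<open>\<eta>\<close> and gradient estimate \<open>g\<close>,
  as a relation between the current point \<open>x\<close> and the next point \<open>x'\<close>.
\<close>

definition prox_step ::
  "'a :: real_inner set \<Rightarrow> ('a \<Rightarrow> real) \<Rightarrow> real \<Rightarrow> 'a \<Rightarrow> 'a \<Rightarrow> 'a \<Rightarrow> bool" where
  "prox_step X \<phi> \<eta> g x x' \<longleftrightarrow>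
     is_arg_min (\<lambda>y. 1 / 2 * (norm (y - (x - \<eta> *\<^sub>R g)))\<^sup>2 + \<phi> (y - x)) (\<lambda>y. y \<in> X) x'"

definition minibatch :: "('a \<Rightarrow> 'z \<Rightarrow> 'a :: real_vector) \<Rightarrow> nat \<Rightarrow> 'a \<Rightarrow> (nat \<Rightarrow> 'z) \<Rightarrow> 'a" where
  "minibatch G m x z = (1 / real m) *\<^sub>R (\<Sum>i=1..m. G x (z i))"

text \<open>
  Independence of two random variables with possibly different value types (the library's
  \<^const>\<open>prob_space.indep_var\<close> requires equal types): independence of the generated
  sigma-algebras.
\<close>

definition (in prob_space) indep_rv ::
  "'b measure \<Rightarrow> ('a \<Rightarrow> 'b) \<Rightarrow> 'c measure \<Rightarrow> ('a \<Rightarrow> 'c) \<Rightarrow> bool" where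
  "indep_rv N1 U N2 V \<longleftrightarrow>
     random_variable N1 U \<and> random_variable N2 V \<and>
     indep_set (sets (vimage_algebra (space M) U N1)) (sets (vimage_algebra (space M) V N2))"

text \<open>
  The constant in the accuracy bound. It has to be uniform in the dimension, that is, in the
  type \<open>'n\<close>, over which one cannot quantify inside a formula; an existential quantifier in a
  theorem about \<open>real ^ 'n\<close> would let the constant depend on the dimension. So a witness is
  named here. Its value is not optimized.

  Where it comes from: for a step \<open>d = x' - x\<close> with stepsize \<open>1 / L\<close> and gradient error \<open>w\<close>
  (in maximum norm), the optimality condition of the step bounds the distance at \<open>x'\<close> by
  \<open>(\<rho> + 2) * L * l1norm d + w\<close>, and \<open>f\<close> decreases by at least
  \<open>(\<rho> - 1) * L * (l1norm d)\<^sup>2 - w\<^sup>2 / (2 * L)\<close>. If the second moment of \<open>w\<close> is at most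
  \<open>c * \<epsilon>\<^sup>2\<close>, then averaging and \<open>\<rho> - 1 > 1 / 2\<close> give the factor
  \<open>(\<rho> + 2) * sqrt (2 + c) + sqrt c\<close>.
\<close>

definition C1 :: "real \<Rightarrow> real" where
  "C1 \<rho> = 20 * (\<rho> + 2)"

end

theory Submission
  imports Defs
begin

text \<open>
  Write \<open>d = x (k + 1) - x k\<close> and let \<open>w\<close> be the maximum norm of the gradient error of the
  \<open>k\<close>-th batch. The optimality condition of the proximal step bounds the distance to
  stationarity at \<open>x (k + 1)\<close> by \<open>(\<rho> + 2) * L * l1norm d + w\<close>, and \<open>f\<close> decreases by at
  least \<open>(\<rho> - 1) * L * (l1norm d)\<^sup>2 - w\<^sup>2 / (2 * L)\<close>. Telescoping controls the mean of
  \<open>L\<^sup>2 * (l1norm d)\<^sup>2\<close> by the second moments of the errors alone. These are of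
  order \<open>ln n * \<sigma>\<^sup>2 / m\<close> in dimension \<open>n\<close>: the squared maximum norm is replaced by the squared
  \<open>(2 * q)\<close>-norm with \<open>q\<close> about \<open>ln n\<close>, which is smooth with a constant of order \<open>q\<close>, so that
  adding an independent centred summand raises its mean by at most a multiple of \<open>q * \<sigma>\<^sup>2\<close>.
\<close>

text \<open>Two obstacles shape the proof. The iterates are given only by a relation, yet
  integrating over a batch first requires the current iterate to be a measurable function of the
  starting point and the earlier samples. Strong convexity of the step objective makes the step
  unique and its solution map continuous, hence measurable; Tonelli then takes the place of
  conditional expectations. The other obstacle is that the distance to stationarity is an infimum
  over a set that varies with the point. Duality of \<open>l1norm\<close> and \<open>infnorm\<close>
  turns a bound \<open>R\<close> at \<open>u\<close> into the inequalities
  \<open>0 \<le> gradf u \<bullet> (y - u) + R * l1norm (y - u)\<close> for all \<open>y\<close> in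
  \<open>X\<close>. They are what the optimality condition of a step delivers, and being closed
  conditions on \<open>u\<close> they also make the distance measurable. As for the logarithm:
  adding up the variances of the coordinates would cost a factor of the dimension \<open>n\<close>.
  In the norm used here the cost is the curvature \<open>2 * q - 1\<close> times the comparison
  factor \<open>n powr (1 / q)\<close>, and \<open>q\<close> near \<open>ln n\<close> balances the
  two.\<close>

section \<open>Norms and the subdifferential\<close>

lemma l1norm_nonneg: "0 \<le> l1norm x"
  by (simp add: l1norm_def sum_nonneg)

lemma l1norm_zero [simp]: "l1norm 0 = 0"
  by (simp add: l1norm_def)

lemma l1norm_scaleR: "l1norm (c *\<^sub>R x) = \<bar>c\<bar> * l1norm x"
  by (simp add: l1norm_def abs_mult sum_distrib_left)

lemma l1norm_triangle: "l1norm (x + y) \<le> l1norm x + l1norm y"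
  by (simp add: l1norm_def sum.distrib[symmetric] sum_mono)

lemma l1norm_minus_commute: "l1norm (x - y) = l1norm (y - x)"
  by (simp add: l1norm_def abs_minus_commute)

lemma continuous_on_l1norm [continuous_intros]:
  "continuous_on A h \<Longrightarrow> continuous_on A (\<lambda>y. l1norm (h y))"
  unfolding l1norm_def by (intro continuous_intros)

lemma tendsto_l1norm [tendsto_intros]:
  "(h \<longlongrightarrow> a) A \<Longrightarrow> ((\<lambda>y. l1norm (h y)) \<longlongrightarrow> l1norm a) A"
  unfolding l1norm_def by (intro tendsto_intros)

lemma l1norm_le_norm:
  fixes x :: "real ^ 'n"
  shows "l1norm x \<le> real CARD('n) * norm x"
  unfolding l1norm_def using sum_bounded_above[of UNIV "\<lambda>i. \<bar>x $ i\<bar>" "norm x"] component_le_norm_cart[of x] by simp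

section \<open>Duality of the l1 norm and the maximum norm\<close>

lemma inner_le_infnorm_l1norm:
  fixes a b :: "real ^ 'n"
  shows "\<bar>a \<bullet> b\<bar> \<le> infnorm a * l1norm b"
proof -
  have "\<bar>a \<bullet> b\<bar> \<le> (\<Sum>i\<in>UNIV. \<bar>a $ i * b $ i\<bar>)"
    unfolding inner_vec_def by simp
  also have "\<dots> \<le> (\<Sum>i\<in>UNIV. infnorm a * \<bar>b $ i\<bar>)"
    by (intro sum_mono) (simp add: abs_mult component_le_infnorm_cart mult_right_mono)
  finally show ?thesis by (simp add: l1norm_def sum_distrib_left)
qed

lemma infnorm_le_iff:
  fixes a :: "real ^ 'n"
  shows "infnorm a \<le> R \<longleftrightarrow> (\<forall>i. \<bar>a $ i\<bar> \<le> R)"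
proof
  assume "\<forall>i. \<bar>a $ i\<bar> \<le> R"
  then show "infnorm a \<le> R"
    unfolding infnorm_cart by (intro cSup_least) auto
qed (meson component_le_infnorm_cart order_trans)

text \<open>Testing with plus and minus a coordinate vector, whose \<open>l1norm\<close> is one,
  isolates each entry of \<open>a\<close>.\<close>

lemma infnorm_le_of_inner_l1norm:
  fixes a :: "real ^ 'n"
  assumes "\<And>z. 0 \<le> a \<bullet> z + R * l1norm z"
  shows "infnorm a \<le> R"
  unfolding infnorm_le_iff
proof
  fix i
  have l: "l1norm (axis i c :: real ^ 'n) = \<bar>c\<bar>" for c :: real
    unfolding l1norm_def axis_def by (simp add: if_distrib [of abs] cong: if_cong)
  show "\<bar>a $ i\<bar> \<le> R"
    using assms[of "axis i 1"] assms[of "axis i (-1)"] by (simp add: l inner_axis)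
qed

text \<open>The epigraph of \<open>R * l1norm\<close> is separated from the hypograph of \<open>z \<mapsto> - (g \<bullet> z)\<close> over
  \<open>X - u\<close>; the slope of the separating hyperplane is the subgradient.\<close>

lemma exists_small_subgradient:
  fixes X :: "(real ^ 'n) set"
  assumes "convex X" and u: "u \<in> X" and R: "0 \<le> R"
    and *: "\<And>y. y \<in> X \<Longrightarrow> 0 \<le> g \<bullet> (y - u) + R * l1norm (y - u)"
  obtains v where "infnorm v \<le> R" and "\<And>y. y \<in> X \<Longrightarrow> (v - g) \<bullet> (y - u) \<le> 0"
proof -
  let ?A = "{p :: (real ^ 'n) \<times> real. R * l1norm (fst p) < snd p}"
  let ?B = "{p :: (real ^ 'n) \<times> real. fst p + u \<in> X \<and> snd p \<le> - (g \<bullet> fst p)}"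
  have "convex ?A"
  proof (rule convexI, clarsimp)
    fix z z' :: "real ^ 'n" and t t' a b :: real
    assume h: "R * l1norm z < t" "R * l1norm z' < t'" "0 \<le> a" "0 \<le> b" "a + b = 1"
    have "R * l1norm (a *\<^sub>R z + b *\<^sub>R z') \<le> R * (a * l1norm z + b * l1norm z')"
      using l1norm_triangle[of "a *\<^sub>R z" "b *\<^sub>R z'"] h R
      by (intro mult_left_mono) (simp_all add: l1norm_scaleR)
    also have "\<dots> = a * (R * l1norm z) + b * (R * l1norm z')" by (simp add: algebra_simps)
    also have "\<dots> < a * t + b * t'"
      using h by (smt (verit, best) mult_left_mono mult_strict_left_mono)
    finally show "R * l1norm (a *\<^sub>R z + b *\<^sub>R z') < a * t + b * t'" .
  qed
  moreover have "convex ?B"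
  proof (rule convexI, clarsimp)
    fix z z' :: "real ^ 'n" and t t' a b :: real
    assume h: "z + u \<in> X" "t \<le> - (g \<bullet> z)" "z' + u \<in> X" "t' \<le> - (g \<bullet> z')"
      "0 \<le> a" "0 \<le> b" "a + b = 1"
    have "a *\<^sub>R z + b *\<^sub>R z' + u = a *\<^sub>R z + b *\<^sub>R z' + (a + b) *\<^sub>R u"
      using h by simp
    also have "\<dots> = a *\<^sub>R (z + u) + b *\<^sub>R (z' + u)" by (simp add: algebra_simps)
    also have "\<dots> \<in> X" using h \<open>convex X\<close> by (auto simp: convex_def)
    finally have "a *\<^sub>R z + b *\<^sub>R z' + u \<in> X" .
    moreover have "a * t + b * t' \<le> a * - (g \<bullet> z) + b * - (g \<bullet> z')"
      using h by (intro add_mono mult_left_mono) auto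
    ultimately show "a *\<^sub>R z + b *\<^sub>R z' + u \<in> X \<and> a * t + b * t' \<le> - (g \<bullet> (a *\<^sub>R z + b *\<^sub>R z'))"
      by (simp add: inner_add_right)
  qed
  moreover have "(0, 1) \<in> ?A" "(0, 0) \<in> ?B" using u by auto
  then have "?A \<noteq> {}" "?B \<noteq> {}" by blast+
  moreover have "?A \<inter> ?B = {}" using *[of "_ + u"] by fastforce
  ultimately obtain p b where p: "p \<noteq> 0" "\<forall>q\<in>?B. p \<bullet> q \<le> b" "\<forall>q\<in>?A. b \<le> p \<bullet> q"
    using separating_hyperplane_sets[of ?B ?A] by (metis (no_types, lifting) Int_commute)
  obtain a \<alpha> where pa: "p = (a, \<alpha>)" by fastforce
  have B: "a \<bullet> z + \<alpha> * t \<le> b" if "z + u \<in> X" "t \<le> - (g \<bullet> z)" for z t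
    using p(2) that pa by auto
  have A: "b \<le> a \<bullet> z + \<alpha> * t" if "R * l1norm z < t" for z t
    using p(3) that pa by auto
  have b0: "0 \<le> b" using B[of 0 0] u by simp
  have Ab: "0 \<le> a \<bullet> z + \<alpha> * t" if "R * l1norm z < t" for z t
    using A[OF that] b0 by linarith
  have ge: "0 \<le> \<alpha>" using Ab[of 0 1] by simp
  \<comment> \<open>The separating hyperplane is not vertical: \<open>?A\<close> projects onto the
    whole space, so with \<open>\<alpha> = 0\<close> the functional \<open>a\<close> would be
    nonnegative everywhere and hence zero.\<close>
  have "\<alpha> \<noteq> 0"
  proof
    assume "\<alpha> = 0"
    then have "0 \<le> a \<bullet> (- a)" using Ab[of "- a" "R * l1norm (- a) + 1"] by simp
    then have "a = 0" by (metis inner_eq_zero_iff inner_ge_zero inner_minus_right neg_0_le_iff_le order_antisym)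
    with \<open>\<alpha> = 0\<close> p(1) pa show False by (simp add: zero_prod_def)
  qed
  with ge have pos: "0 < \<alpha>" by simp
  \<comment> \<open>The points \<open>(0, e / \<alpha>)\<close> of \<open>?A\<close> approach the
    origin, which lies in \<open>?B\<close>.\<close>
  have b_le: "b \<le> 0"
  proof (rule field_le_epsilon)
    fix e :: real assume "0 < e"
    then show "b \<le> 0 + e" using A[of 0 "e / \<alpha>"] pos by simp
  qed
  let ?v = "(1 / \<alpha>) *\<^sub>R a"
  have "0 \<le> ?v \<bullet> z + R * l1norm z" for z
  proof (rule field_le_epsilon)
    fix e :: real assume "0 < e"
    then have "0 \<le> a \<bullet> z + \<alpha> * (R * l1norm z + e)" using Ab[of z "R * l1norm z + e"] by simp
    then have "0 \<le> (a \<bullet> z + \<alpha> * (R * l1norm z + e)) / \<alpha>" using pos by simp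
    then show "0 \<le> ?v \<bullet> z + R * l1norm z + e" using pos by (simp add: field_simps)
  qed
  then have "infnorm ?v \<le> R" by (rule infnorm_le_of_inner_l1norm)
  moreover have "(?v - g) \<bullet> (y - u) \<le> 0" if "y \<in> X" for y
  proof -
    have "a \<bullet> (y - u) + \<alpha> * - (g \<bullet> (y - u)) \<le> 0" using B[of "y - u" "- (g \<bullet> (y - u))"] that b_le by simp
    then have "(a \<bullet> (y - u) + \<alpha> * - (g \<bullet> (y - u))) / \<alpha> \<le> 0" using pos by (simp add: divide_le_0_iff)
    then show ?thesis using pos by (simp add: inner_diff_left field_simps)
  qed
  ultimately show ?thesis using that by blast
qed

section \<open>The subdifferential of a smooth function plus an indicator\<close>

lemma eventually_gderiv_bound:
  fixes f :: "'a :: real_inner \<Rightarrow> real"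
  assumes "GDERIV f u :> g" "0 < e"
  shows "\<forall>\<^sub>F y in at u. \<bar>f y - f u - g \<bullet> (y - u)\<bar> \<le> e * norm (y - u)"
proof -
  have "(f has_derivative (\<lambda>h. h \<bullet> g)) (at u)"
    using assms(1) by (simp add: gderiv_def)
  then obtain d where d: "0 < d"
    "\<And>y. norm (y - u) < d \<Longrightarrow> norm (f y - f u - (y - u) \<bullet> g) \<le> e * norm (y - u)"
    using \<open>0 < e\<close> unfolding has_derivative_at_alt by blast
  then show ?thesis
    unfolding eventually_at by (auto simp: dist_norm inner_commute intro!: exI[of _ d])
qed

text \<open>Convexity turns the local liminf condition into a global inequality: any
  \<open>y\<close> in \<open>X\<close> can be moved towards \<open>u\<close> along the segment, and
  the inequality is homogeneous in \<open>y - u\<close>. The set obtained is the gradient plus the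
  normal cone of \<open>X\<close> at \<open>u\<close>. Off \<open>X\<close> the quotient is
  infinite, so only points of \<open>X\<close> constrain \<open>v\<close>.\<close>

lemma frechet_subdiff_set_ind_iff:
  fixes f :: "'a :: real_inner \<Rightarrow> real"
  assumes conv: "convex X" and der: "GDERIV f u :> g"
  shows "v \<in> frechet_subdiff (\<lambda>y. ereal (f y) + set_ind X y) u
    \<longleftrightarrow> u \<in> X \<and> (\<forall>y\<in>X. (v - g) \<bullet> (y - u) \<le> 0)"
proof (cases "u \<in> X")
  case False
  then show ?thesis by (simp add: frechet_subdiff_def set_ind_def)
next
  case u: True
  let ?Q = "\<lambda>y. (ereal (f y) + set_ind X y - (ereal (f u) + set_ind X u) - ereal (v \<bullet> (y - u))) / ereal (norm (y - u))"
  have Q: "?Q y = ereal ((f y - f u - v \<bullet> (y - u)) / norm (y - u))" if "y \<in> X" "y \<noteq> u" for y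
    using that u by (simp add: set_ind_def)
  have Q': "?Q y = \<infinity>" if "y \<notin> X" "y \<noteq> u" for y
    using that u by (simp add: set_ind_def divide_ereal_def)
  have "v \<in> frechet_subdiff (\<lambda>y. ereal (f y) + set_ind X y) u \<longleftrightarrow> (\<forall>c<0. \<forall>\<^sub>F y in at u. c < ?Q y)"
    using u by (simp add: frechet_subdiff_def le_Liminf_iff set_ind_def[of X u])
  also have "\<dots> \<longleftrightarrow> (\<forall>y\<in>X. (v - g) \<bullet> (y - u) \<le> 0)"
  proof (intro iffI ballI allI impI)
    fix y assume *: "\<forall>c<0. \<forall>\<^sub>F y in at u. c < ?Q y" and y: "y \<in> X"
    show "(v - g) \<bullet> (y - u) \<le> 0"
    proof (cases "y = u")
      case False
      show ?thesis
      proof (rule field_le_epsilon)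
        fix e0 :: real assume "0 < e0"
        \<comment> \<open>The derivative estimate and the liminf each cost \<open>e\<close> times
          the norm, so together they cost \<open>e0\<close> at distance
          \<open>norm (y - u)\<close>.\<close>
        define e where "e = e0 / (2 * norm (y - u))"
        have e: "0 < e" using \<open>0 < e0\<close> False by (simp add: e_def)
        have "\<forall>\<^sub>F z in at u. ereal (- e) < ?Q z" using * e by simp
        with eventually_gderiv_bound[OF der e]
        have "\<forall>\<^sub>F z in at u. \<bar>f z - f u - g \<bullet> (z - u)\<bar> \<le> e * norm (z - u) \<and> ereal (- e) < ?Q z"
          by (rule eventually_conj)
        then obtain d where d: "0 < d" "\<And>z. z \<noteq> u \<Longrightarrow> dist z u < d \<Longrightarrow>
            \<bar>f z - f u - g \<bullet> (z - u)\<bar> \<le> e * norm (z - u) \<and> ereal (- e) < ?Q z"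
          unfolding eventually_at by auto
        define t where "t = min 1 (d / (2 * norm (y - u)))"
        have t: "0 < t" "t \<le> 1" using d False by (auto simp: t_def)
        define z where "z = u + t *\<^sub>R (y - u)"
        have zX: "z \<in> X"
          using convexD_alt[OF conv u y, of t] t by (simp add: z_def algebra_simps)
        have zu: "z - u = t *\<^sub>R (y - u)" "z \<noteq> u" using t False by (auto simp: z_def)
        have "t * norm (y - u) \<le> d / 2"
        proof -
          have "t * norm (y - u) \<le> d / (2 * norm (y - u)) * norm (y - u)"
            by (intro mult_right_mono) (auto simp: t_def)
          then show ?thesis using False by simp
        qed
        then have "dist z u < d" using zu t d(1) by (simp add: dist_norm)
        with d(2) zu(2) have 1: "\<bar>f z - f u - g \<bullet> (z - u)\<bar> \<le> e * norm (z - u)" and 2: "ereal (- e) < ?Q z"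
          by blast+
        have "- e < (f z - f u - v \<bullet> (z - u)) / norm (z - u)"
          using 2 Q[OF zX zu(2)] by simp
        then have "- e * norm (z - u) < f z - f u - v \<bullet> (z - u)"
          using zu(2) by (simp add: pos_less_divide_eq)
        with 1 have "(v - g) \<bullet> (z - u) \<le> 2 * e * norm (z - u)" by (simp add: inner_diff_left)
        then have "t * ((v - g) \<bullet> (y - u)) \<le> t * (2 * e * norm (y - u))" 
          unfolding zu(1) using t by (simp add: mult_ac)
        then have "(v - g) \<bullet> (y - u) \<le> 2 * e * norm (y - u)" using t by simp
        then show "(v - g) \<bullet> (y - u) \<le> 0 + e0" using False by (simp add: e_def)
      qed
    qed simp
  next
    fix c :: ereal assume *: "\<forall>y\<in>X. (v - g) \<bullet> (y - u) \<le> 0" and c: "c < 0"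
    then obtain e where e: "0 < e" "c < ereal (- e)"
      by (metis ereal_dense2 ereal_less(1) ereal_less_eq(3) less_ereal.simps(1) neg_less_0_iff_less uminus_ereal.simps(1) add.inverse_inverse zero_ereal_def)
    have "\<forall>\<^sub>F y in at u. y \<noteq> u" by (simp add: eventually_at_filter)
    with eventually_gderiv_bound[OF der e(1)] show "\<forall>\<^sub>F y in at u. c < ?Q y"
    proof eventually_elim
      case (elim y)
      show ?case
      proof (cases "y \<in> X")
        case True
        then have "v \<bullet> (y - u) \<le> g \<bullet> (y - u)" using * by (simp add: inner_diff_left)
        then have "- e * norm (y - u) \<le> f y - f u - v \<bullet> (y - u)" using elim by simp
        then have "- e \<le> (f y - f u - v \<bullet> (y - u)) / norm (y - u)" using elim by (simp add: pos_le_divide_eq)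
        then have "ereal (- e) \<le> ?Q y" unfolding Q[OF True elim(2)] by (simp only: ereal_less_eq)
        with e(2) show ?thesis by (rule less_le_trans)
      next
        case False
        show ?thesis unfolding Q'[OF False elim(2)] using c by auto
      qed
    qed
  qed
  finally show ?thesis using u by simp
qed

text \<open>From left to right, pair an almost optimal subgradient with \<open>y - u\<close>;
  working with \<open>R + e\<close> avoids asking whether the infimum is attained. From right to
  left, separation produces a subgradient of size at most \<open>R\<close>. The right-hand side no
  longer mentions subgradients, which is the point of the lemma.\<close>

lemma dist0_inf_subdiff_le_iff:
  fixes X :: "(real ^ 'n) set"
  assumes conv: "convex X" and der: "GDERIV f u :> g" and R: "0 \<le> R"
  shows "dist0_inf (frechet_subdiff (\<lambda>y. ereal (f y) + set_ind X y) u) \<le> ennreal R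
    \<longleftrightarrow> u \<in> X \<and> (\<forall>y\<in>X. 0 \<le> g \<bullet> (y - u) + R * l1norm (y - u))"
proof
  assume le: "dist0_inf (frechet_subdiff (\<lambda>y. ereal (f y) + set_ind X y) u) \<le> ennreal R"
  have ex: "\<exists>v. u \<in> X \<and> (\<forall>y\<in>X. (v - g) \<bullet> (y - u) \<le> 0) \<and> infnorm v < R + e" if "0 < e" for e
  proof -
    have "dist0_inf (frechet_subdiff (\<lambda>y. ereal (f y) + set_ind X y) u) < ennreal (R + e)"
      using le that R by (elim order_le_less_trans) (simp add: ennreal_lessI)
    then show ?thesis
      unfolding dist0_inf_def INF_less_iff using frechet_subdiff_set_ind_iff[OF conv der] R that
      by (metis ennreal_less_iff infnorm_pos_le)
  qed
  have "0 \<le> g \<bullet> (y - u) + R * l1norm (y - u)" if y: "y \<in> X" for y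
  proof (rule field_le_epsilon)
    fix e0 :: real assume e0: "0 < e0"
    \<comment> \<open>The added 1 keeps the denominator positive when \<open>y = u\<close>.\<close>
    define e where "e = e0 / (l1norm (y - u) + 1)"
    have e: "0 < e" "e * l1norm (y - u) \<le> e0"
      using e0 l1norm_nonneg[of "y - u"] by (auto simp: e_def field_simps)
    obtain v where v: "(v - g) \<bullet> (y - u) \<le> 0" "infnorm v < R + e" using ex[OF e(1)] y by blast
    have "- (v \<bullet> (y - u)) \<le> infnorm v * l1norm (y - u)"
      using inner_le_infnorm_l1norm[of v "y - u"] by linarith
    also have "\<dots> \<le> (R + e) * l1norm (y - u)"
      using v(2) by (intro mult_right_mono l1norm_nonneg) simp
    finally show "0 \<le> g \<bullet> (y - u) + R * l1norm (y - u) + e0"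
      using v(1) e(2) by (simp add: inner_diff_left algebra_simps)
  qed
  then show "u \<in> X \<and> (\<forall>y\<in>X. 0 \<le> g \<bullet> (y - u) + R * l1norm (y - u))"
    using ex[of 1] by auto
next
  assume "u \<in> X \<and> (\<forall>y\<in>X. 0 \<le> g \<bullet> (y - u) + R * l1norm (y - u))"
  then obtain v where v: "infnorm v \<le> R" "u \<in> X" "\<And>y. y \<in> X \<Longrightarrow> (v - g) \<bullet> (y - u) \<le> 0"
    using exists_small_subgradient[OF conv _ R] by metis
  then have "v \<in> frechet_subdiff (\<lambda>y. ereal (f y) + set_ind X y) u"
    using frechet_subdiff_set_ind_iff[OF conv der] by blast
  then have "dist0_inf (frechet_subdiff (\<lambda>y. ereal (f y) + set_ind X y) u) \<le> ennreal (infnorm v)"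
    unfolding dist0_inf_def by (rule INF_lower)
  also have "\<dots> \<le> ennreal R" using v(1) by (rule ennreal_leI)
  finally show "dist0_inf (frechet_subdiff (\<lambda>y. ereal (f y) + set_ind X y) u) \<le> ennreal R" .
qed

text \<open>Each sublevel set at a finite level is an intersection over all \<open>y\<close> in
  \<open>X\<close>. This intersection may be uncountable, but its members are closed, so it is
  closed and hence Borel.\<close>

lemma borel_measurable_dist0_inf_subdiff:
  fixes X :: "(real ^ 'n) set"
  assumes "closed X" "convex X" and der: "\<And>u. GDERIV f u :> gradf u"
    and cont: "continuous_on X gradf"
  shows "(\<lambda>u. dist0_inf (frechet_subdiff (\<lambda>y. ereal (f y) + set_ind X y) u)) \<in> borel_measurable borel"
proof (rule borel_measurableI_le)
  fix r :: ennreal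
  show "{u \<in> space borel. dist0_inf (frechet_subdiff (\<lambda>y. ereal (f y) + set_ind X y) u) \<le> r} \<in> sets borel"
  proof (cases r)
    case (real R)
    have "{u \<in> space borel. dist0_inf (frechet_subdiff (\<lambda>y. ereal (f y) + set_ind X y) u) \<le> r}
      = X \<inter> (\<Inter>y\<in>X. {u \<in> X. 0 \<le> gradf u \<bullet> (y - u) + R * l1norm (y - u)})"
      unfolding real using dist0_inf_subdiff_le_iff[OF \<open>convex X\<close> der \<open>0 \<le> R\<close>] by auto
    moreover have "closed {u \<in> X. 0 \<le> gradf u \<bullet> (y - u) + R * l1norm (y - u)}" for y
      using \<open>closed X\<close> cont
      by (intro continuous_closed_preimage[where S = X and T = "{0..}" and f = "\<lambda>u. gradf u \<bullet> (y - u) + R * l1norm (y - u)", simplified vimage_def Int_def atLeast_iff mem_Collect_eq] continuous_intros) auto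
    then have "closed (X \<inter> (\<Inter>y\<in>X. {u \<in> X. 0 \<le> gradf u \<bullet> (y - u) + R * l1norm (y - u)}))"
      using \<open>closed X\<close> by auto
    ultimately show ?thesis by simp
  qed simp
qed

text \<open>Along the segment, which stays in \<open>X\<close>, the difference between
  \<open>f\<close> and its quadratic upper model has nonpositive derivative, by the Hoelder
  inequality for the two dual norms. Monotonicity of this difference replaces an integral of the
  gradient.\<close>

lemma descent_l1norm:
  fixes X :: "(real ^ 'n) set"
  assumes conv: "convex X" and der: "\<And>u. GDERIV f u :> gradf u"
    and smooth: "\<And>u v. u \<in> X \<Longrightarrow> v \<in> X \<Longrightarrow> infnorm (gradf u - gradf v) \<le> L * l1norm (u - v)"
    and x: "x \<in> X" and y: "y \<in> X"
  shows "f y \<le> f x + gradf x \<bullet> (y - x) + L / 2 * (l1norm (y - x))\<^sup>2"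
proof -
  define d where "d = y - x"
  let ?h = "\<lambda>t. f (x + t *\<^sub>R d) - t * (gradf x \<bullet> d) - L / 2 * t\<^sup>2 * (l1norm d)\<^sup>2"
  have D: "(?h has_real_derivative
      gradf (x + t *\<^sub>R d) \<bullet> d - gradf x \<bullet> d - L * t * (l1norm d)\<^sup>2) (at t)" for t
  proof -
    have "(f has_derivative (\<lambda>h. h \<bullet> gradf (x + t *\<^sub>R d))) (at (x + t *\<^sub>R d))"
      using der by (simp add: gderiv_def)
    moreover have "((\<lambda>t. x + t *\<^sub>R d) has_derivative (\<lambda>s. s *\<^sub>R d)) (at t)"
      by (auto intro!: derivative_eq_intros)
    ultimately have "((\<lambda>t. f (x + t *\<^sub>R d)) has_derivative (\<lambda>s. (s *\<^sub>R d) \<bullet> gradf (x + t *\<^sub>R d))) (at t)"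
      using has_derivative_compose by fastforce
    then have "((\<lambda>t. f (x + t *\<^sub>R d)) has_real_derivative gradf (x + t *\<^sub>R d) \<bullet> d) (at t)"
      unfolding has_field_derivative_def by (simp add: inner_commute mult.commute[of _ "_ \<bullet> _"])
    then show ?thesis
      by (auto intro!: derivative_eq_intros simp: power2_eq_square)
  qed
  have "?h 1 \<le> ?h 0"
  proof (rule DERIV_nonpos_imp_nonincreasing[where f = ?h])
    fix t :: real assume t: "0 \<le> t" "t \<le> 1"
    have "x + t *\<^sub>R d \<in> X"
      using convexD_alt[OF conv x y, of t] t by (simp add: d_def algebra_simps)
    then have "infnorm (gradf (x + t *\<^sub>R d) - gradf x) \<le> L * l1norm (t *\<^sub>R d)"
      using smooth[of "x + t *\<^sub>R d" x] x by simp
    then have "infnorm (gradf (x + t *\<^sub>R d) - gradf x) * l1norm d \<le> L * t * l1norm d * l1norm d"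
      using t by (intro mult_right_mono l1norm_nonneg) (simp add: l1norm_scaleR)
    with inner_le_infnorm_l1norm[of "gradf (x + t *\<^sub>R d) - gradf x" d]
    have "gradf (x + t *\<^sub>R d) \<bullet> d - gradf x \<bullet> d - L * t * (l1norm d)\<^sup>2 \<le> 0"
      by (simp add: inner_diff_left power2_eq_square)
    with D show "\<exists>z. (?h has_real_derivative z) (at t) \<and> z \<le> 0" by blast
  qed simp
  then show ?thesis by (simp add: d_def algebra_simps)
qed

section \<open>The proximal step\<close>

definition prox_obj :: "real \<Rightarrow> real \<Rightarrow> real ^ 'n \<Rightarrow> real ^ 'n \<Rightarrow> real ^ 'n \<Rightarrow> real" where
  "prox_obj \<rho> \<eta> g x y = 1 / 2 * (norm (y - (x - \<eta> *\<^sub>R g)))\<^sup>2 + \<rho> / 2 * (l1norm (y - x))\<^sup>2"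

lemma prox_step_iff:
  "prox_step X (\<lambda>u. \<rho> / 2 * (l1norm u)\<^sup>2) \<eta> g x x'
    \<longleftrightarrow> x' \<in> X \<and> (\<forall>y\<in>X. prox_obj \<rho> \<eta> g x x' \<le> prox_obj \<rho> \<eta> g x y)"
  unfolding prox_step_def is_arg_min_linorder prox_obj_def by auto

text \<open>Divide by \<open>t\<close> and let \<open>t\<close> tend to 0. This extracts first-order
  conditions from minimality along a segment without differentiating \<open>l1norm\<close>.\<close>

lemma nonneg_of_quadratic_nonneg:
  fixes a b :: real
  assumes "\<And>t. 0 < t \<Longrightarrow> t \<le> 1 \<Longrightarrow> 0 \<le> t * a + t\<^sup>2 * b"
  shows "0 \<le> a"
proof (rule ccontr)
  assume "\<not> 0 \<le> a"
  then have a: "a < 0" by simp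
  \<comment> \<open>Small enough that \<open>t * b\<close> is at most half of \<open>- a\<close>, so
    that \<open>a + t * b\<close> stays negative.\<close>
  define t where "t = min 1 (- a / (2 * (\<bar>b\<bar> + 1)))"
  have t: "0 < t" "t \<le> 1" using a by (auto simp: t_def divide_neg_pos)
  have "t * (\<bar>b\<bar> + 1) \<le> - a / (2 * (\<bar>b\<bar> + 1)) * (\<bar>b\<bar> + 1)"
    by (intro mult_right_mono) (auto simp: t_def)
  also have "\<dots> = - a / 2"
  proof -
    have *: "- a / (2 * c) * c = - a / 2" if "0 < c" for c :: real using that by simp
    show ?thesis by (rule *) linarith
  qed
  finally have "t * (\<bar>b\<bar> + 1) \<le> - a / 2" .
  moreover have "t * b \<le> t * (\<bar>b\<bar> + 1)" using t by (intro mult_left_mono) auto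
  ultimately have "a + t * b < 0" using a by linarith
  then have "t * (a + t * b) < 0" using t by (simp add: mult_pos_neg)
  then show False using assms[OF t] by (simp add: algebra_simps power2_eq_square)
qed

text \<open>Both parts compare \<open>x'\<close> with nearby points of a segment in
  \<open>X\<close>. For a general \<open>y\<close> the triangle inequality bounds the change of the
  l1 term. Moving back towards \<open>x\<close> scales \<open>d\<close> by exactly
  \<open>1 - t\<close>, so there the l1 term decreases; this gives \<open>- \<rho>\<close> in the
  second part, where the first part with \<open>y = x\<close> would give only
  \<open>+ \<rho>\<close>.\<close>

lemma prox_step_variational:
  fixes X :: "(real ^ 'n) set"
  assumes conv: "convex X" and x: "x \<in> X" and \<rho>: "0 \<le> \<rho>"
    and step: "prox_step X (\<lambda>u. \<rho> / 2 * (l1norm u)\<^sup>2) \<eta> g x x'"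
  shows "\<And>y. y \<in> X \<Longrightarrow>
      0 \<le> (x' - x + \<eta> *\<^sub>R g) \<bullet> (y - x') + \<rho> * l1norm (x' - x) * l1norm (y - x')"
    and "(x' - x + \<eta> *\<^sub>R g) \<bullet> (x' - x) \<le> - \<rho> * (l1norm (x' - x))\<^sup>2"
proof -
  define d where "d = x' - x"
  define w where "w = d + \<eta> *\<^sub>R g"
  have x': "x' \<in> X" and min: "\<And>y. y \<in> X \<Longrightarrow> prox_obj \<rho> \<eta> g x x' \<le> prox_obj \<rho> \<eta> g x y"
    using step unfolding prox_step_iff by auto
  have line: "0 \<le> t * (w \<bullet> z) + t\<^sup>2 * ((norm z)\<^sup>2 / 2)
      + \<rho> / 2 * ((l1norm (d + t *\<^sub>R z))\<^sup>2 - (l1norm d)\<^sup>2)"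
    if "x' + z \<in> X" "0 < t" "t \<le> 1" for t z
  proof -
    have "x' + t *\<^sub>R z \<in> X"
      using convexD_alt[OF conv x' that(1), of t] that by (simp add: algebra_simps)
    then have "prox_obj \<rho> \<eta> g x x' \<le> prox_obj \<rho> \<eta> g x (x' + t *\<^sub>R z)" by (rule min)
    moreover have "prox_obj \<rho> \<eta> g x (x' + t *\<^sub>R z)
        = 1 / 2 * (norm (w + t *\<^sub>R z))\<^sup>2 + \<rho> / 2 * (l1norm (d + t *\<^sub>R z))\<^sup>2"
      "prox_obj \<rho> \<eta> g x x' = 1 / 2 * (norm w)\<^sup>2 + \<rho> / 2 * (l1norm d)\<^sup>2"
      by (simp_all add: prox_obj_def w_def d_def algebra_simps)
    moreover have "(norm (w + t *\<^sub>R z))\<^sup>2 = (norm w)\<^sup>2 + 2 * t * (w \<bullet> z) + t\<^sup>2 * (norm z)\<^sup>2"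
      unfolding power2_norm_eq_inner
      by (simp add: inner_add_left inner_add_right inner_commute[of z w] power2_eq_square algebra_simps)
    ultimately show ?thesis
      by (simp add: right_diff_distrib add_divide_distrib)
  qed
  show "0 \<le> (x' - x + \<eta> *\<^sub>R g) \<bullet> (y - x') + \<rho> * l1norm (x' - x) * l1norm (y - x')"
    if y: "y \<in> X" for y
  proof -
    define z where "z = y - x'"
    have "0 \<le> w \<bullet> z + \<rho> * l1norm d * l1norm z"
    proof (rule nonneg_of_quadratic_nonneg)
      fix t :: real assume t: "0 < t" "t \<le> 1"
      have "l1norm (d + t *\<^sub>R z) \<le> l1norm d + t * l1norm z"
        using l1norm_triangle[of d "t *\<^sub>R z"] t by (simp add: l1norm_scaleR)
      then have "(l1norm (d + t *\<^sub>R z))\<^sup>2 \<le> (l1norm d + t * l1norm z)\<^sup>2"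
        using l1norm_nonneg by (intro power_mono)
      then have "\<rho> / 2 * ((l1norm (d + t *\<^sub>R z))\<^sup>2 - (l1norm d)\<^sup>2)
          \<le> \<rho> / 2 * ((l1norm d + t * l1norm z)\<^sup>2 - (l1norm d)\<^sup>2)"
        using \<rho> by (intro mult_left_mono) auto
      with line[of z t] t y show "0 \<le> t * (w \<bullet> z + \<rho> * l1norm d * l1norm z)
          + t\<^sup>2 * ((norm z)\<^sup>2 / 2 + \<rho> / 2 * (l1norm z)\<^sup>2)"
        by (simp add: z_def[symmetric] power2_sum power_mult_distrib algebra_simps) (simp add: z_def)
    qed
    then show ?thesis by (simp add: w_def d_def z_def)
  qed
  have "0 \<le> - (w \<bullet> d) - \<rho> * (l1norm d)\<^sup>2"
  proof (rule nonneg_of_quadratic_nonneg)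
    fix t :: real assume t: "0 < t" "t \<le> 1"
    have "d + t *\<^sub>R (- d) = (1 - t) *\<^sub>R d" by (simp add: algebra_simps)
    then have "(l1norm (d + t *\<^sub>R (- d)))\<^sup>2 = (1 - t)\<^sup>2 * (l1norm d)\<^sup>2"
      by (simp only: l1norm_scaleR power_mult_distrib power2_abs)
    moreover have "x' + - d \<in> X" using x by (simp add: d_def)
    note line[OF this t]
    ultimately have "0 \<le> t * (w \<bullet> - d) + t\<^sup>2 * ((norm (- d))\<^sup>2 / 2)
        + \<rho> / 2 * ((1 - t)\<^sup>2 * (l1norm d)\<^sup>2 - (l1norm d)\<^sup>2)"
      by (simp only:)
    then show "0 \<le> t * (- (w \<bullet> d) - \<rho> * (l1norm d)\<^sup>2)
        + t\<^sup>2 * ((norm d)\<^sup>2 / 2 + \<rho> / 2 * (l1norm d)\<^sup>2)"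
      by (simp add: power2_diff algebra_simps)
  qed
  then show "(x' - x + \<eta> *\<^sub>R g) \<bullet> (x' - x) \<le> - \<rho> * (l1norm (x' - x))\<^sup>2"
    by (simp add: w_def d_def)
qed

text \<open>Strong convexity, tested at the midpoint of \<open>x'\<close> and \<open>y\<close>: the
  parallelogram identity supplies the gain from the Euclidean term, and the l1 term is convex. The
  single test point yields the constant 1/4 in place of the sharp 1/2.\<close>

lemma prox_step_quadratic_growth:
  fixes X :: "(real ^ 'n) set"
  assumes conv: "convex X" and \<rho>: "0 \<le> \<rho>"
    and step: "prox_step X (\<lambda>u. \<rho> / 2 * (l1norm u)\<^sup>2) \<eta> g x x'" and y: "y \<in> X"
  shows "prox_obj \<rho> \<eta> g x x' + 1 / 4 * (norm (y - x'))\<^sup>2 \<le> prox_obj \<rho> \<eta> g x y"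
proof -
  define a where "a = y - (x - \<eta> *\<^sub>R g)"
  define b where "b = x' - (x - \<eta> *\<^sub>R g)"
  define z where "z = (1 / 2) *\<^sub>R (y + x')"
  have x': "x' \<in> X" and min: "\<And>y. y \<in> X \<Longrightarrow> prox_obj \<rho> \<eta> g x x' \<le> prox_obj \<rho> \<eta> g x y"
    using step unfolding prox_step_iff by auto
  have "z \<in> X" using convexD[OF conv y x', of "1/2" "1/2"] by (simp add: z_def scaleR_add_right)
  then have 1: "prox_obj \<rho> \<eta> g x x' \<le> prox_obj \<rho> \<eta> g x z" by (rule min)
  have half: "(1 / 2) *\<^sub>R v + (1 / 2) *\<^sub>R v = v" for v :: "real ^ 'n"
    by (simp add: scaleR_add_left[symmetric])
  have "z - (x - \<eta> *\<^sub>R g) = (1 / 2) *\<^sub>R (a + b)"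
    using half[of "x - \<eta> *\<^sub>R g"] by (simp add: z_def a_def b_def algebra_simps)
  then have 2: "(norm (z - (x - \<eta> *\<^sub>R g)))\<^sup>2 = 1 / 2 * (norm a)\<^sup>2 + 1 / 2 * (norm b)\<^sup>2 - 1 / 4 * (norm (y - x'))\<^sup>2"
  proof -
    have yx': "y - x' = a - b" by (simp add: a_def b_def)
    show ?thesis
      unfolding yx' \<open>z - (x - \<eta> *\<^sub>R g) = (1 / 2) *\<^sub>R (a + b)\<close> power2_norm_eq_inner
      by (simp add: inner_add_left inner_add_right inner_diff_left inner_diff_right inner_commute[of b a] field_simps)
  qed
  have "z - x = (1 / 2) *\<^sub>R (y - x) + (1 / 2) *\<^sub>R (x' - x)"
    using half[of x] by (simp add: z_def algebra_simps)
  then have "l1norm (z - x) \<le> 1 / 2 * l1norm (y - x) + 1 / 2 * l1norm (x' - x)"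
    using l1norm_triangle[of "(1 / 2) *\<^sub>R (y - x)" "(1 / 2) *\<^sub>R (x' - x)"] by (simp add: l1norm_scaleR)
  then have "(l1norm (z - x))\<^sup>2 \<le> (1 / 2 * l1norm (y - x) + 1 / 2 * l1norm (x' - x))\<^sup>2"
    by (intro power_mono l1norm_nonneg)
  also have "\<dots> \<le> 1 / 2 * (l1norm (y - x))\<^sup>2 + 1 / 2 * (l1norm (x' - x))\<^sup>2"
    using zero_le_power2[of "l1norm (y - x) - l1norm (x' - x)"]
    by (simp add: power2_sum power2_diff field_simps power2_eq_square)
  finally have "\<rho> / 2 * (l1norm (z - x))\<^sup>2 \<le> \<rho> / 2 * (1 / 2 * (l1norm (y - x))\<^sup>2 + 1 / 2 * (l1norm (x' - x))\<^sup>2)"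
    using \<rho> by (intro mult_left_mono) auto
  then have 3: "\<rho> / 2 * (l1norm (z - x))\<^sup>2
      \<le> 1 / 2 * (\<rho> / 2 * (l1norm (y - x))\<^sup>2) + 1 / 2 * (\<rho> / 2 * (l1norm (x' - x))\<^sup>2)"
    by (simp add: algebra_simps)
  have "prox_obj \<rho> \<eta> g x y = 1 / 2 * (norm a)\<^sup>2 + \<rho> / 2 * (l1norm (y - x))\<^sup>2"
    "prox_obj \<rho> \<eta> g x x' = 1 / 2 * (norm b)\<^sup>2 + \<rho> / 2 * (l1norm (x' - x))\<^sup>2"
    by (simp_all only: prox_obj_def a_def b_def)
  with 1 2 3 show ?thesis
    unfolding prox_obj_def[of \<rho> \<eta> g x z] by linarith
qed

section \<open>Well-posedness, stability and measurability of the step\<close>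

lemma prox_step_unique:
  fixes X :: "(real ^ 'n) set"
  assumes "convex X" "0 \<le> \<rho>"
    and "prox_step X (\<lambda>u. \<rho> / 2 * (l1norm u)\<^sup>2) \<eta> g x y"
    and "prox_step X (\<lambda>u. \<rho> / 2 * (l1norm u)\<^sup>2) \<eta> g x y'"
  shows "y = y'"
proof -
  have "y' \<in> X" using assms(4) unfolding prox_step_iff by simp
  then have "prox_obj \<rho> \<eta> g x y + 1 / 4 * (norm (y' - y))\<^sup>2 \<le> prox_obj \<rho> \<eta> g x y'"
    using prox_step_quadratic_growth assms by blast
  moreover have "prox_obj \<rho> \<eta> g x y' \<le> prox_obj \<rho> \<eta> g x y"
    using assms(3,4) unfolding prox_step_iff by blast
  ultimately have "(norm (y' - y))\<^sup>2 \<le> 0" by linarith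
  then show ?thesis by simp
qed

text \<open>\<open>X\<close> may be unbounded, so the minimum is sought in a compact part of it, cut
  out by a ball that contains every point at least as good as \<open>x\<close>.\<close>

lemma prox_step_exists:
  fixes X :: "(real ^ 'n) set"
  assumes "closed X" "x \<in> X" "0 \<le> \<rho>"
  shows "\<exists>y. prox_step X (\<lambda>u. \<rho> / 2 * (l1norm u)\<^sup>2) \<eta> g x y"
proof -
  define r where "r = sqrt (2 * prox_obj \<rho> \<eta> g x x)"
  define B where "B = X \<inter> cball (x - \<eta> *\<^sub>R g) r"
  have inB: "y \<in> B" if "y \<in> X" "prox_obj \<rho> \<eta> g x y \<le> prox_obj \<rho> \<eta> g x x" for y
  proof -
    have "0 \<le> \<rho> / 2 * (l1norm (y - x))\<^sup>2" using assms by simp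
    with that(2) have "1 / 2 * (norm (y - (x - \<eta> *\<^sub>R g)))\<^sup>2 \<le> prox_obj \<rho> \<eta> g x x"
      unfolding prox_obj_def[of \<rho> \<eta> g x y] by linarith
    then have "norm (y - (x - \<eta> *\<^sub>R g)) \<le> r"
      unfolding r_def by (intro real_le_rsqrt) simp
    then show ?thesis using that(1) by (simp add: B_def dist_norm norm_minus_commute)
  qed
  have "compact B" using assms(1) by (simp add: B_def closed_Int_compact)
  moreover have "B \<noteq> {}" using inB[OF assms(2)] by auto
  moreover have "continuous_on B (prox_obj \<rho> \<eta> g x)"
    unfolding prox_obj_def by (intro continuous_intros)
  ultimately obtain y where y: "y \<in> B" "\<And>z. z \<in> B \<Longrightarrow> prox_obj \<rho> \<eta> g x y \<le> prox_obj \<rho> \<eta> g x z"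
    using continuous_attains_inf by metis
  have "prox_obj \<rho> \<eta> g x y \<le> prox_obj \<rho> \<eta> g x z" if "z \<in> X" for z
    using y(2)[of z] y(2)[of x] inB[of x] inB[of z] that assms(2) by force
  then show ?thesis using y(1) unfolding prox_step_iff B_def by blast
qed

text \<open>Adding the growth inequality at \<open>(x, g)\<close>, tested with \<open>y'\<close>, to the one at \<open>(x', g')\<close>,
  tested with \<open>y\<close>.\<close>

lemma prox_step_stability:
  fixes X :: "(real ^ 'n) set"
  assumes conv: "convex X" and \<rho>: "0 \<le> \<rho>"
    and y: "prox_step X (\<lambda>u. \<rho> / 2 * (l1norm u)\<^sup>2) \<eta> g x y"
    and y': "prox_step X (\<lambda>u. \<rho> / 2 * (l1norm u)\<^sup>2) \<eta> g' x' y'"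
  defines "e \<equiv> l1norm (x' - x)" and "\<delta> \<equiv> norm ((x' - \<eta> *\<^sub>R g') - (x - \<eta> *\<^sub>R g))"
  shows "norm (y' - y) \<le> 2 * (\<delta> + \<rho> * e * real CARD('n)) + sqrt (2 * \<rho> * e * (2 * l1norm (y - x) + e))"
proof -
  define s where "s = norm (y' - y)"
  define p where "p = x - \<eta> *\<^sub>R g"
  define p' where "p' = x' - \<eta> *\<^sub>R g'"
  define D where "D = l1norm (y' - y)"
  define A where "A = l1norm (y - x)"
  have e: "0 \<le> e" unfolding e_def by (rule l1norm_nonneg)
  have D: "0 \<le> D" "D \<le> real CARD('n) * s" unfolding D_def s_def by (rule l1norm_nonneg l1norm_le_norm)+
  have A: "0 \<le> A" unfolding A_def by (rule l1norm_nonneg)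
  have yX: "y \<in> X" "y' \<in> X" using y y' unfolding prox_step_iff by auto
  have "1 / 2 * s\<^sup>2 \<le> prox_obj \<rho> \<eta> g x y' - prox_obj \<rho> \<eta> g x y + prox_obj \<rho> \<eta> g' x' y - prox_obj \<rho> \<eta> g' x' y'"
    using prox_step_quadratic_growth[OF conv \<rho> y yX(2)] prox_step_quadratic_growth[OF conv \<rho> y' yX(1)]
    by (simp add: s_def norm_minus_commute)
  also have "\<dots> = (y' - y) \<bullet> (p' - p)
      + \<rho> / 2 * (((l1norm (y' - x))\<^sup>2 - (l1norm (y' - x'))\<^sup>2) + ((l1norm (y - x'))\<^sup>2 - (l1norm (y - x))\<^sup>2))"
  proof -
    have "1 / 2 * (norm (y' - p))\<^sup>2 - 1 / 2 * (norm (y - p))\<^sup>2 + 1 / 2 * (norm (y - p'))\<^sup>2 - 1 / 2 * (norm (y' - p'))\<^sup>2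
      = (y' - y) \<bullet> (p' - p)"
      unfolding power2_norm_eq_inner
      by (simp add: inner_diff_left inner_diff_right inner_commute[of p y] inner_commute[of p y'] inner_commute[of p' y] inner_commute[of p' y'] algebra_simps)
    then show ?thesis
      by (simp add: prox_obj_def p_def[symmetric] p'_def[symmetric] right_diff_distrib distrib_left)
  qed
  also have "\<dots> \<le> s * \<delta> + \<rho> / 2 * (e * (2 * (D + A) + e) + e * (2 * A + e))"
  proof (rule add_mono)
    show "(y' - y) \<bullet> (p' - p) \<le> s * \<delta>"
      unfolding s_def \<delta>_def p_def p'_def by (rule norm_cauchy_schwarz)
    have sq: "u\<^sup>2 - v\<^sup>2 \<le> e * (2 * c + e)" if "u \<le> v + e" "v \<le> c" "0 \<le> u" "0 \<le> v" for u v c :: real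
    proof -
      have "u\<^sup>2 \<le> (v + e)\<^sup>2" using that by (intro power_mono)
      moreover have "e * v \<le> e * c" using that e by (intro mult_left_mono)
      ultimately show ?thesis by (simp add: power2_sum algebra_simps power2_eq_square)
    qed
    have tri: "l1norm (u - w) \<le> l1norm (u - v) + l1norm (v - w)" for u v w :: "real ^ 'n"
      using l1norm_triangle[of "u - v" "v - w"] by simp
    \<comment> \<open>The distance from \<open>y'\<close> to \<open>x'\<close> may exceed
      \<open>D + A\<close>. In that case it also exceeds the distance from \<open>y'\<close> to
      \<open>x\<close>, which is at most \<open>D + A\<close>, and the difference of squares is
      negative.\<close>
    have "(l1norm (y' - x))\<^sup>2 - (l1norm (y' - x'))\<^sup>2 \<le> e * (2 * (D + A) + e)"
    proof (cases "l1norm (y' - x') \<le> D + A")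
      case True
      then show ?thesis
        by (intro sq l1norm_nonneg) (use tri[of y' x x'] in \<open>auto simp: e_def\<close>)
    next
      case False
      have "l1norm (y' - x) \<le> D + A" unfolding D_def A_def by (rule tri)
      then have "(l1norm (y' - x))\<^sup>2 \<le> (l1norm (y' - x'))\<^sup>2"
        using False by (intro power_mono l1norm_nonneg) auto
      moreover have "0 \<le> e * (2 * (D + A) + e)" using e D A by simp
      ultimately show ?thesis by linarith
    qed
    moreover have "(l1norm (y - x'))\<^sup>2 - (l1norm (y - x))\<^sup>2 \<le> e * (2 * A + e)"
      by (intro sq l1norm_nonneg) (use tri[of y x' x] in \<open>auto simp: e_def A_def l1norm_minus_commute\<close>)
    ultimately show "\<rho> / 2 * (((l1norm (y' - x))\<^sup>2 - (l1norm (y' - x'))\<^sup>2) + ((l1norm (y - x'))\<^sup>2 - (l1norm (y - x))\<^sup>2))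
        \<le> \<rho> / 2 * (e * (2 * (D + A) + e) + e * (2 * A + e))"
      using \<rho> by (intro mult_left_mono) auto
  qed
  also have "\<dots> = s * \<delta> + \<rho> * e * D + \<rho> * e * (2 * A + e)"
    by (simp add: algebra_simps)
  also have "\<dots> \<le> s * \<delta> + \<rho> * e * (real CARD('n) * s) + \<rho> * e * (2 * A + e)"
    using D \<rho> e by (intro add_mono mult_left_mono order_refl) auto
  finally have main: "s * (s - 2 * (\<delta> + \<rho> * e * real CARD('n))) \<le> 2 * \<rho> * e * (2 * A + e)"
    by (simp add: algebra_simps power2_eq_square)
  define \<alpha> where "\<alpha> = 2 * (\<delta> + \<rho> * e * real CARD('n))"
  define \<beta> where "\<beta> = 2 * \<rho> * e * (2 * A + e)"
  have ab: "0 \<le> \<alpha>" "0 \<le> \<beta>" using \<rho> e A by (auto simp: \<alpha>_def \<beta>_def \<delta>_def)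
  \<comment> \<open>This solves the quadratic inequality
    \<open>s * (s - \<alpha>) \<le> \<beta>\<close>. The square root leaves a Hoelder rather than a
    Lipschitz estimate in \<open>x\<close>, which still gives continuity.\<close>
  have "s - \<alpha> \<le> sqrt \<beta>"
  proof (cases "s \<le> \<alpha>")
    case False
    then have "(s - \<alpha>)\<^sup>2 \<le> s * (s - \<alpha>)" using ab by (simp add: power2_eq_square mult_right_mono)
    also have "\<dots> \<le> \<beta>" using main by (simp add: \<alpha>_def \<beta>_def)
    finally show ?thesis by (rule real_le_rsqrt)
  next
    case True
    moreover have "0 \<le> sqrt \<beta>" using ab by simp
    ultimately show ?thesis by linarith
  qed
  then show ?thesis by (simp add: s_def \<alpha>_def \<beta>_def A_def)
qed

text \<open>A function selected from the relation \<open>prox_step\<close>. By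
  \<open>prox_step_unique\<close> the given iterates are its values, so its continuity transfers to
  them as measurability.\<close>

definition prox_map :: "(real ^ 'n) set \<Rightarrow> real \<Rightarrow> real \<Rightarrow> real ^ 'n \<Rightarrow> real ^ 'n \<Rightarrow> real ^ 'n" where
  "prox_map X \<rho> \<eta> x g = (SOME y. prox_step X (\<lambda>u. \<rho> / 2 * (l1norm u)\<^sup>2) \<eta> g x y)"

lemma prox_step_prox_map:
  fixes X :: "(real ^ 'n) set"
  assumes "closed X" "x \<in> X" "0 \<le> \<rho>"
  shows "prox_step X (\<lambda>u. \<rho> / 2 * (l1norm u)\<^sup>2) \<eta> g x (prox_map X \<rho> \<eta> x g)"
  unfolding prox_map_def by (rule someI_ex) (rule prox_step_exists[OF assms])

lemma continuous_on_prox_map: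
  fixes X :: "(real ^ 'n) set"
  assumes "closed X" "convex X" "0 \<le> \<rho>"
  shows "continuous_on (X \<times> UNIV) (\<lambda>(x, g). prox_map X \<rho> \<eta> x g)"
  unfolding continuous_on_def
proof clarify
  fix x g :: "real ^ 'n" assume x: "x \<in> X"
  define y where "y = prox_map X \<rho> \<eta> x g"
  let ?F = "at (x, g) within X \<times> UNIV"
  let ?e = "\<lambda>q :: (real ^ 'n) \<times> (real ^ 'n). l1norm (fst q - x)"
  let ?b = "\<lambda>q. 2 * (norm ((fst q - \<eta> *\<^sub>R snd q) - (x - \<eta> *\<^sub>R g)) + \<rho> * ?e q * real CARD('n))
      + sqrt (2 * \<rho> * ?e q * (2 * l1norm (y - x) + ?e q))"
  have "continuous_on (X \<times> UNIV) ?b" by (intro continuous_intros)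
  then have "(?b \<longlongrightarrow> ?b (x, g)) ?F" using x unfolding continuous_on_def by blast
  then have b: "(?b \<longlongrightarrow> 0) ?F" by simp
  have "((\<lambda>q. (case q of (x, g) \<Rightarrow> prox_map X \<rho> \<eta> x g) - y) \<longlongrightarrow> 0) ?F"
  proof (rule Lim_null_comparison[OF _ b])
    show "\<forall>\<^sub>F q in ?F. norm ((case q of (x, g) \<Rightarrow> prox_map X \<rho> \<eta> x g) - y) \<le> ?b q"
      unfolding eventually_at_filter
    proof (intro always_eventually allI impI)
      fix q assume "q \<in> X \<times> (UNIV :: (real ^ 'n) set)"
      then obtain x' g' where q: "q = (x', g')" "x' \<in> X" by blast
      show "norm ((case q of (x, g) \<Rightarrow> prox_map X \<rho> \<eta> x g) - y) \<le> ?b q"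
        unfolding q(1) y_def
        using prox_step_stability[OF assms(2,3) prox_step_prox_map[OF assms(1) x assms(3)] prox_step_prox_map[OF assms(1) q(2) assms(3)]]
        by simp
    qed
  qed
  then have "((\<lambda>q. (case q of (x, g) \<Rightarrow> prox_map X \<rho> \<eta> x g) - y + y) \<longlongrightarrow> 0 + y) ?F"
    by (intro tendsto_add tendsto_const)
  then show "((\<lambda>(x, g). prox_map X \<rho> \<eta> x g) \<longlongrightarrow> prox_map X \<rho> \<eta> x g) ?F"
    by (simp add: y_def)
qed

text \<open>Source and target both carry the trace sigma-algebra on \<open>X\<close>, so that the
  new point can be fed back into the step and into \<open>G\<close>, whose measurability is assumed
  over \<open>X\<close> only.\<close>

lemma measurable_prox_map:
  fixes X :: "(real ^ 'n) set"
  assumes "closed X" "convex X" "0 \<le> \<rho>"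
    and u: "u \<in> measurable N (restrict_space borel X)" and g: "g \<in> borel_measurable N"
  shows "(\<lambda>w. prox_map X \<rho> \<eta> (u w) (g w)) \<in> measurable N (restrict_space borel X)"
proof (rule measurable_restrict_space2)
  have uX: "u w \<in> X" if "w \<in> space N" for w
    using measurable_space[OF u that] by (simp add: space_restrict_space)
  show "(\<lambda>w. prox_map X \<rho> \<eta> (u w) (g w)) \<in> space N \<rightarrow> X"
    using prox_step_prox_map[OF assms(1) uX assms(3)] unfolding prox_step_iff by blast
  have ub: "u \<in> borel_measurable N"
    using u by (simp add: measurable_restrict_space2_iff)
  have "(\<lambda>w. (u w, g w)) \<in> measurable N (restrict_space borel (X \<times> UNIV))"
    by (rule measurable_restrict_space2) (use uX ub g in \<open>auto intro: borel_measurable_Pair\<close>)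
  from measurable_compose[OF this borel_measurable_continuous_on_restrict[OF continuous_on_prox_map[OF assms(1-3)]]]
  show "(\<lambda>w. prox_map X \<rho> \<eta> (u w) (g w)) \<in> borel_measurable N" by simp
qed

section \<open>A maximal inequality for sums of independent vectors\<close>

text \<open>The offset \<open>\<delta> > 0\<close> keeps the squared \<open>(2 * q)\<close>-norm twice differentiable at the origin.\<close>

definition smooth_max :: "nat \<Rightarrow> real \<Rightarrow> real ^ 'n \<Rightarrow> real" where
  "smooth_max q \<delta> z = (\<delta> + (\<Sum>i\<in>UNIV. (z $ i) ^ (2 * q))) powr (1 / real q)"

definition smooth_max_grad :: "nat \<Rightarrow> real \<Rightarrow> real ^ 'n \<Rightarrow> real ^ 'n" where
  "smooth_max_grad q \<delta> z =
     (\<chi> i. 2 * (\<delta> + (\<Sum>j\<in>UNIV. (z $ j) ^ (2 * q))) powr (1 / real q - 1) * (z $ i) ^ (2 * q - 1))"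

lemma smooth_max_nonneg: "0 \<le> smooth_max q \<delta> z"
  by (simp add: smooth_max_def)

lemma smooth_max_zero: "0 < q \<Longrightarrow> smooth_max q \<delta> 0 = \<delta> powr (1 / real q)"
  by (simp add: smooth_max_def power_0_left)

lemma infnorm_sq_le_smooth_max:
  fixes z :: "real ^ 'n"
  assumes q: "0 < q" and \<delta>: "0 \<le> \<delta>"
  shows "(infnorm z)\<^sup>2 \<le> smooth_max q \<delta> z"
proof -
  have "\<bar>z $ i\<bar> \<le> sqrt (smooth_max q \<delta> z)" for i
  proof -
    have "(z $ i) ^ (2 * q) \<le> \<delta> + (\<Sum>i\<in>UNIV. (z $ i) ^ (2 * q))"
      using \<delta> member_le_sum[of i UNIV "\<lambda>i. (z $ i) ^ (2 * q)"] by (simp add: power_mult)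
    then have "((z $ i) ^ (2 * q)) powr (1 / q) \<le> smooth_max q \<delta> z"
      unfolding smooth_max_def by (intro powr_mono2) (auto simp: power_mult)
    moreover have "((z $ i) ^ (2 * q)) powr (1 / q) = (z $ i)\<^sup>2"
    proof (cases "z $ i = 0")
      case False
      then show ?thesis using q by (simp add: power_mult powr_realpow[symmetric] powr_powr)
    qed (use q in simp)
    ultimately show ?thesis by (metis real_sqrt_abs real_sqrt_le_iff)
  qed
  then have "infnorm z \<le> sqrt (smooth_max q \<delta> z)" by (simp add: infnorm_le_iff)
  then show ?thesis
    using infnorm_pos_le[of z] smooth_max_nonneg[of q \<delta> z]
    by (metis power_mono real_sqrt_pow2)
qed

text \<open>Hoelder's inequality against the constant function 1, in terms of an upper bound
  \<open>A\<close> of the power sum. In the application \<open>A\<close> is that sum plus the offset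
  \<open>\<delta>\<close>, which makes it positive.\<close>

lemma sum_power_pred_le:
  fixes u :: "'n :: finite \<Rightarrow> real"
  assumes q: "1 \<le> q" and u: "\<And>i. 0 \<le> u i" and A: "(\<Sum>i\<in>UNIV. u i ^ q) \<le> A" "0 < A"
  shows "(\<Sum>i\<in>UNIV. u i ^ (q - 1)) \<le> real CARD('n) powr (1 / real q) * A powr (1 - 1 / real q)"
proof -
  define p where "p = 1 / real q"
  define n where "n = real CARD('n)"
  have n: "0 < n" by (simp add: n_def)
  have p: "0 < p" "p \<le> 1" using q by (auto simp: p_def)
  have qp: "real q * p = 1" using q by (simp add: p_def)
  define c where "c = (A / n) powr p"
  have c: "0 < c" using A n by (simp add: c_def)
  have "(\<Sum>i\<in>UNIV. u i ^ (q - 1)) * c = (\<Sum>i\<in>UNIV. u i ^ (q - 1) * c)"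
    by (simp add: sum_distrib_right)
  also have "\<dots> \<le> (\<Sum>i\<in>UNIV. (1 - p) * u i ^ q + p * (A / n))"
    \<comment> \<open>weighted AM-GM; the weight \<open>c\<close> makes both terms sum to multiples of \<open>A\<close>\<close>
  proof (rule sum_mono)
    fix i
    show "u i ^ (q - 1) * c \<le> (1 - p) * u i ^ q + p * (A / n)"
    \<comment> \<open>For \<open>q = 1\<close> and a zero entry the power is
      \<open>0 ^ 0 = 1\<close>, whereas \<open>0 powr 0 = 0\<close>, so the rewriting through
      \<open>powr\<close> below is confined to positive entries.\<close>
    proof (cases "u i = 0")
      case True
      show ?thesis
      proof (cases "q = 1")
        case False
        then show ?thesis using True q p A n by (simp add: power_0_left)
      qed (use A n in \<open>simp add: p_def c_def\<close>)
    next
      case False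
      then have ui: "0 < u i" using u[of i] by simp
      have "u i ^ (q - 1) = (u i ^ q) powr (1 - p)"
      proof -
        have "(u i ^ q) powr (1 - p) = u i powr (real q * (1 - p))"
          using ui by (simp add: powr_realpow[symmetric] powr_powr)
        also have "real q * (1 - p) = real (q - 1)" using q qp by (simp add: algebra_simps of_nat_diff)
        finally show ?thesis using ui by (simp add: powr_realpow)
      qed
      then have "u i ^ (q - 1) * c = (u i ^ q) powr (1 - p) * (A / n) powr p" by (simp add: c_def)
      also have "\<dots> \<le> (1 - p) * u i ^ q + p * (A / n)"
        by (rule Youngs_inequality_0) (use p ui A n in auto)
      finally show ?thesis .
    qed
  qed
  also have "\<dots> = (1 - p) * (\<Sum>i\<in>UNIV. u i ^ q) + p * A"
    using n by (simp add: sum.distrib sum_distrib_left n_def)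
  also have "\<dots> \<le> (1 - p) * A + p * A" using A p by (intro add_mono mult_left_mono) auto
  also have "\<dots> = A" by (simp add: algebra_simps)
  finally have "(\<Sum>i\<in>UNIV. u i ^ (q - 1)) \<le> A / c" using c by (simp add: pos_le_divide_eq)
  also have "A / c = n powr p * A powr (1 - p)"
    using A n by (simp add: c_def powr_divide powr_diff)
  finally show ?thesis by (simp add: p_def n_def)
qed

text \<open>The term of the second derivative that involves \<open>(g')\<^sup>2\<close> is nonpositive, because
  \<open>1 / q \<le> 1\<close>.\<close>

lemma smooth_max_add_le:
  fixes a h :: "real ^ 'n"
  assumes q: "1 \<le> q" and \<delta>: "0 < \<delta>"
  shows "smooth_max q \<delta> (a + h) \<le> smooth_max q \<delta> a + smooth_max_grad q \<delta> a \<bullet> h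
    + (2 * real q - 1) * real CARD('n) powr (1 / real q) * (infnorm h)\<^sup>2"
proof -
  define p where "p = 1 / real q"
  have p: "0 < p" "p \<le> 1" and qp: "real q * p = 1" using q by (auto simp: p_def)
  define n where "n = real CARD('n) powr p"
  define B where "B = infnorm h"
  define g where "g t = \<delta> + (\<Sum>i\<in>UNIV. (a $ i + t * h $ i) ^ (2 * q))" for t
  define g1 where "g1 t = (\<Sum>i\<in>UNIV. real (2 * q) * (a $ i + t * h $ i) ^ (2 * q - 1) * h $ i)" for t
  define g2 where "g2 t = (\<Sum>i\<in>UNIV. real (2 * q) * real (2 * q - 1) * (a $ i + t * h $ i) ^ (2 * q - 2) * (h $ i)\<^sup>2)" for t
  have gpos: "0 < g t" for t
    using \<delta> by (simp add: g_def add_pos_nonneg sum_nonneg power_mult)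
  have dg: "(g has_real_derivative g1 t) (at t)" for t
    unfolding g_def[abs_def] g1_def
    by (rule derivative_eq_intros refl | simp add: mult_ac)+
  have dg1: "(g1 has_real_derivative g2 t) (at t)" for t
  proof -
    have "2 * q - 1 - 1 = 2 * q - 2" by simp
    then show ?thesis
    unfolding g1_def[abs_def] g2_def
    by - (rule derivative_eq_intros refl | simp add: mult_ac power2_eq_square)+
  qed
  \<comment> \<open>The function \<open>smooth_max\<close> along the line \<open>a + t * h\<close>
    and its first two derivatives. Taylor's formula on the unit interval then leaves a second-order
    remainder at an intermediate \<open>t\<close>.\<close>
  define D where "D m t = (if m = 0 then g t powr p else if m = 1 then p * g t powr (p - 1) * g1 t
      else p * ((p - 1) * g t powr (p - 2) * g1 t * g1 t + g t powr (p - 1) * g2 t))" for m :: nat and t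
  have "\<exists>t. 0 < t \<and> t < 1 \<and> D 0 1 = (\<Sum>m<2. D m 0 / fact m * (1 - 0) ^ m) + D 2 t / fact 2 * (1 - 0) ^ 2"
  proof (rule Taylor_up)
    show "\<forall>m t. m < 2 \<and> 0 \<le> t \<and> t \<le> 1 \<longrightarrow> (D m has_real_derivative D (Suc m) t) (at t)"
    proof (intro allI impI)
      fix m :: nat and t :: real assume "m < 2 \<and> 0 \<le> t \<and> t \<le> 1"
      then consider "m = 0" | "m = 1" by linarith
      then show "(D m has_real_derivative D (Suc m) t) (at t)"
      proof cases
        case 1
        have "((\<lambda>t. g t powr p) has_real_derivative p * g t powr (p - 1) * g1 t) (at t)"
          using gpos by (auto intro!: derivative_eq_intros dg)
        then show ?thesis using 1 by (simp add: D_def[abs_def])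
      next
        case 2
        have "((\<lambda>t. g t powr (p - 1)) has_real_derivative (p - 1) * g t powr (p - 1 - 1) * g1 t) (at t)"
          using gpos by (auto intro!: derivative_eq_intros dg simp del: diff_diff_add simp: algebra_simps)
        from DERIV_cmult[OF DERIV_mult[OF this dg1], of p]
        have "((\<lambda>t. p * g t powr (p - 1) * g1 t) has_real_derivative
            p * ((p - 1) * g t powr (p - 2) * g1 t * g1 t + g t powr (p - 1) * g2 t)) (at t)"
          by (simp add: algebra_simps)
        then show ?thesis using 2 by (simp add: D_def[abs_def])
      qed
    qed
  qed auto
  then obtain t where t: "D 0 1 = D 0 0 + D 1 0 + D 2 t / 2"
    by (auto simp: numeral_2_eq_2)
  have "D 2 t \<le> p * (g t powr (p - 1) * g2 t)"
  proof -
    have "(p - 1) * (g t powr (p - 2) * (g1 t * g1 t)) \<le> 0"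
      using p by (intro mult_nonpos_nonneg) auto
    then show ?thesis using p by (simp add: D_def mult.assoc)
  qed
  \<comment> \<open>Every \<open>(h $ i)\<^sup>2\<close> is at most \<open>B\<^sup>2\<close>, and
    the remaining sum of powers is bounded by \<open>sum_power_pred_le\<close> with
    \<open>A = g t\<close>. The resulting power of \<open>g t\<close> is the inverse of the one in
    front, so the bound no longer depends on \<open>t\<close>.\<close>
  also have "\<dots> \<le> p * (g t powr (p - 1) * (real (2 * q) * real (2 * q - 1) * B\<^sup>2 * (n * g t powr (1 - p))))"
  proof -
    have "g2 t \<le> (\<Sum>i\<in>UNIV. real (2 * q) * real (2 * q - 1) * ((a $ i + t * h $ i)\<^sup>2) ^ (q - 1) * B\<^sup>2)"
      unfolding g2_def
    proof (rule sum_mono)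
      fix i
      have "(h $ i)\<^sup>2 \<le> B\<^sup>2"
        unfolding B_def by (metis abs_ge_zero component_le_infnorm_cart power2_abs power_mono)
      moreover have "(a $ i + t * h $ i) ^ (2 * q - 2) = ((a $ i + t * h $ i)\<^sup>2) ^ (q - 1)"
        by (simp add: power_mult[symmetric] right_diff_distrib')
      ultimately show "real (2 * q) * real (2 * q - 1) * (a $ i + t * h $ i) ^ (2 * q - 2) * (h $ i)\<^sup>2
          \<le> real (2 * q) * real (2 * q - 1) * ((a $ i + t * h $ i)\<^sup>2) ^ (q - 1) * B\<^sup>2"
        by (simp only:) (intro mult_left_mono, auto)
    qed
    also have "\<dots> = real (2 * q) * real (2 * q - 1) * B\<^sup>2 * (\<Sum>i\<in>UNIV. ((a $ i + t * h $ i)\<^sup>2) ^ (q - 1))"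
      by (simp add: sum_distrib_left mult_ac)
    also have "\<dots> \<le> real (2 * q) * real (2 * q - 1) * B\<^sup>2 * (n * g t powr (1 - p))"
    proof (rule mult_left_mono)
      show "(\<Sum>i\<in>UNIV. ((a $ i + t * h $ i)\<^sup>2) ^ (q - 1)) \<le> n * g t powr (1 - p)"
        unfolding n_def p_def
        by (rule sum_power_pred_le) (use q \<delta> gpos[of t] in \<open>auto simp: g_def power_mult\<close>)
    qed auto
    finally show ?thesis using p by (intro mult_left_mono) auto
  qed
  also have "\<dots> = 2 * (2 * real q - 1) * n * B\<^sup>2"
  proof -
    have "g t powr (p - 1) * g t powr (1 - p) = 1"
      using gpos[of t] by (simp add: powr_add[symmetric])
    then have "g t powr (p - 1) * (n * g t powr (1 - p)) = n" by (simp add: mult.left_commute)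
    moreover have "p * (g t powr (p - 1) * (real (2 * q) * real (2 * q - 1) * B\<^sup>2 * (n * g t powr (1 - p))))
      = 2 * (real q * p) * real (2 * q - 1) * B\<^sup>2 * (g t powr (p - 1) * (n * g t powr (1 - p)))"
      by (simp only: of_nat_mult of_nat_numeral mult_ac)
    ultimately have "p * (g t powr (p - 1) * (real (2 * q) * real (2 * q - 1) * B\<^sup>2 * (n * g t powr (1 - p))))
      = 2 * real (2 * q - 1) * B\<^sup>2 * n"
      by (simp only: qp mult_1_right)
    also have "\<dots> = 2 * (2 * real q - 1) * n * B\<^sup>2" using q by (simp add: of_nat_diff)
    finally show ?thesis .
  qed
  finally have "D 2 t / 2 \<le> (2 * real q - 1) * n * B\<^sup>2" by (simp only: mult.assoc)
  moreover have "D 0 1 = smooth_max q \<delta> (a + h)" "D 0 0 = smooth_max q \<delta> a"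
    by (simp_all add: D_def g_def smooth_max_def p_def)
  moreover have "D 1 0 = smooth_max_grad q \<delta> a \<bullet> h"
  proof -
    have "D 1 0 = p * g 0 powr (p - 1) * (\<Sum>i\<in>UNIV. real (2 * q) * (a $ i) ^ (2 * q - 1) * h $ i)"
      by (simp add: D_def g1_def)
    also have "\<dots> = (\<Sum>i\<in>UNIV. (p * real (2 * q)) * g 0 powr (p - 1) * (a $ i) ^ (2 * q - 1) * h $ i)"
      by (simp add: sum_distrib_left mult_ac)
    also have "p * real (2 * q) = 2" using qp by (simp add: mult.commute)
    finally show ?thesis by (simp add: smooth_max_grad_def inner_vec_def g_def p_def)
  qed
  ultimately show ?thesis using t by (simp add: n_def p_def B_def)
qed

lemma borel_measurable_smooth_max [measurable]:
  "smooth_max q \<delta> \<in> borel_measurable (borel :: (real ^ 'n) measure)"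
  unfolding smooth_max_def by measurable

lemma borel_measurable_infnorm [measurable]: "infnorm \<in> borel_measurable borel"
  by (intro borel_measurable_continuous_onI continuous_intros)

text \<open>The linear term of \<open>smooth_max_add_le\<close> integrates to zero because
  \<open>h\<close> is centred; only the second-order term is paid.\<close>

lemma nn_integral_smooth_max_add_le:
  fixes h :: "'z \<Rightarrow> real ^ 'n"
  assumes D: "prob_space D" and q: "1 \<le> q" and \<delta>: "0 < \<delta>"
    and mean: "has_bochner_integral D h 0"
    and var: "(\<integral>\<^sup>+z. ennreal ((infnorm (h z))\<^sup>2) \<partial>D) \<le> ennreal (\<sigma>\<^sup>2)"
  shows "(\<integral>\<^sup>+z. ennreal (smooth_max q \<delta> (a + h z)) \<partial>D)
    \<le> ennreal (smooth_max q \<delta> a + (2 * real q - 1) * real CARD('n) powr (1 / real q) * \<sigma>\<^sup>2)"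
proof -
  interpret prob_space D by fact
  define c where "c = (2 * real q - 1) * real CARD('n) powr (1 / real q)"
  have c: "0 \<le> c" using q by (simp add: c_def)
  have [measurable]: "h \<in> borel_measurable D" and hi: "integrable D h" and h0: "(\<integral>z. h z \<partial>D) = 0"
    using mean by (auto simp: has_bochner_integral_iff)
  have i2: "integrable D (\<lambda>z. (infnorm (h z))\<^sup>2)"
    by (rule integrableI_nonneg) (use var in \<open>auto simp: order_le_less_trans\<close>)
  have le2: "(\<integral>z. (infnorm (h z))\<^sup>2 \<partial>D) \<le> \<sigma>\<^sup>2"
    using var nn_integral_eq_integral[OF i2] by simp
  let ?r = "\<lambda>z. smooth_max q \<delta> a + smooth_max_grad q \<delta> a \<bullet> h z + c * (infnorm (h z))\<^sup>2"
  have le: "smooth_max q \<delta> (a + h z) \<le> ?r z" for z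
    unfolding c_def by (rule smooth_max_add_le[OF q \<delta>])
  have ri: "integrable D ?r" using hi i2 by simp
  have "(\<integral>\<^sup>+z. ennreal (smooth_max q \<delta> (a + h z)) \<partial>D) \<le> (\<integral>\<^sup>+z. ennreal (?r z) \<partial>D)"
    by (intro nn_integral_mono ennreal_leI le)
  also have "\<dots> = ennreal (\<integral>z. ?r z \<partial>D)"
    by (intro nn_integral_eq_integral ri AE_I2) (meson le order_trans smooth_max_nonneg)
  also have "(\<integral>z. ?r z \<partial>D) = smooth_max q \<delta> a + c * (\<integral>z. (infnorm (h z))\<^sup>2 \<partial>D)"
    using hi i2 h0 by (simp add: prob_space)
  also have "ennreal \<dots> \<le> ennreal (smooth_max q \<delta> a + c * \<sigma>\<^sup>2)"
    using le2 c by (intro ennreal_leI add_mono mult_left_mono) auto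
  finally show ?thesis by (simp add: c_def)
qed

text \<open>In the induction on \<open>J\<close> the new coordinate is integrated first, with the
  old sum as the fixed vector \<open>a\<close>. Each summand adds the same cost, so the growth is
  linear in \<open>card J\<close>; the offset enters once, through the empty sum.\<close>

lemma nn_integral_smooth_max_sum_le:
  fixes h :: "'z \<Rightarrow> real ^ 'n"
  assumes D: "prob_space D" and q: "1 \<le> q" and \<delta>: "0 < \<delta>"
    and mean: "has_bochner_integral D h 0"
    and var: "(\<integral>\<^sup>+z. ennreal ((infnorm (h z))\<^sup>2) \<partial>D) \<le> ennreal (\<sigma>\<^sup>2)"
    and J: "finite J"
  shows "(\<integral>\<^sup>+z. ennreal (smooth_max q \<delta> (\<Sum>j\<in>J. h (z j))) \<partial>PiM J (\<lambda>_. D))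
    \<le> ennreal (\<delta> powr (1 / real q) + real (card J) * ((2 * real q - 1) * real CARD('n) powr (1 / real q) * \<sigma>\<^sup>2))"
  using J
proof induction
  case empty
  show ?case
    using q D by (simp add: smooth_max_zero prob_space.emeasure_space_1[OF prob_space_PiM])
next
  case (insert j J)
  interpret P: product_prob_space "\<lambda>_. D" by (intro product_prob_spaceI D)
  interpret PJ: prob_space "PiM J (\<lambda>_. D)" using D by (intro prob_space_PiM)
  define c where "c = (2 * real q - 1) * real CARD('n) powr (1 / real q) * \<sigma>\<^sup>2"
  have c: "0 \<le> c" using q by (simp add: c_def)
  have [measurable]: "h \<in> borel_measurable D" using mean by (auto simp: has_bochner_integral_iff)
  have "(\<integral>\<^sup>+z. ennreal (smooth_max q \<delta> (\<Sum>i\<in>insert j J. h (z i))) \<partial>PiM (insert j J) (\<lambda>_. D))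
    = (\<integral>\<^sup>+z. \<integral>\<^sup>+y. ennreal (smooth_max q \<delta> (\<Sum>i\<in>insert j J. h ((z(j := y)) i))) \<partial>D \<partial>PiM J (\<lambda>_. D))"
    by (rule P.product_nn_integral_insert) (use insert in \<open>auto intro!: measurable_compose[OF _ borel_measurable_smooth_max, THEN measurable_compose[OF _ measurable_ennreal]] borel_measurable_sum measurable_compose[OF measurable_component_singleton]\<close>)
  also have "\<dots> \<le> (\<integral>\<^sup>+z. ennreal (smooth_max q \<delta> (\<Sum>i\<in>J. h (z i))) + ennreal c \<partial>PiM J (\<lambda>_. D))"
  proof (rule nn_integral_mono)
    fix z
    have *: "(\<Sum>i\<in>insert j J. h ((z(j := y)) i)) = (\<Sum>i\<in>J. h (z i)) + h y" for y
      using insert by (auto simp: add.commute intro!: sum.cong)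
    show "(\<integral>\<^sup>+y. ennreal (smooth_max q \<delta> (\<Sum>i\<in>insert j J. h ((z(j := y)) i))) \<partial>D)
      \<le> ennreal (smooth_max q \<delta> (\<Sum>i\<in>J. h (z i))) + ennreal c"
      unfolding * ennreal_plus[OF smooth_max_nonneg c, symmetric]
      unfolding c_def by (rule nn_integral_smooth_max_add_le[OF D q \<delta> mean var])
  qed
  also have "\<dots> = (\<integral>\<^sup>+z. ennreal (smooth_max q \<delta> (\<Sum>i\<in>J. h (z i))) \<partial>PiM J (\<lambda>_. D)) + ennreal c"
    by (subst nn_integral_add) (auto simp: PJ.emeasure_space_1 intro!: measurable_compose[OF _ borel_measurable_smooth_max, THEN measurable_compose[OF _ measurable_ennreal]] borel_measurable_sum measurable_compose[OF measurable_component_singleton])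
  also have "\<dots> \<le> ennreal (\<delta> powr (1 / real q) + real (card J) * c) + ennreal c"
    using insert.IH by (intro add_right_mono) (simp add: c_def)
  also have "\<dots> = ennreal (\<delta> powr (1 / real q) + real (card (insert j J)) * c)"
    using insert c by (simp add: ennreal_plus[symmetric] algebra_simps del: ennreal_plus)
  finally show ?case by (simp add: c_def)
qed

text \<open>The exponent \<open>q\<close> is about \<open>ln d\<close>, so that \<open>d powr (1 / q) \<le> exp 1\<close>.\<close>

lemma nn_integral_infnorm_sum_sq_le:
  fixes h :: "'z \<Rightarrow> real ^ 'n"
  assumes D: "prob_space D" and d: "2 \<le> CARD('n)" and \<sigma>: "0 < \<sigma>\<^sup>2"
    and mean: "has_bochner_integral D h 0"
    and var: "(\<integral>\<^sup>+z. ennreal ((infnorm (h z))\<^sup>2) \<partial>D) \<le> ennreal (\<sigma>\<^sup>2)"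
    and J: "finite J" "J \<noteq> {}"
  shows "(\<integral>\<^sup>+z. ennreal ((infnorm (\<Sum>j\<in>J. h (z j)))\<^sup>2) \<partial>PiM J (\<lambda>_. D))
    \<le> ennreal (14 * ln (real CARD('n)) * real (card J) * \<sigma>\<^sup>2)"
proof -
  define l where "l = ln (real CARD('n))"
  define q where "q = nat \<lceil>l\<rceil>"
  \<comment> \<open>Dimension at least 2 keeps the logarithm away from 0, so additive constants can
    be absorbed into multiples of \<open>l\<close>.\<close>
  have l: "2 / 3 \<le> l"
  proof -
    have "2 / 3 \<le> ln (2 :: real)" using ln2_ge_two_thirds by simp
    also have "\<dots> \<le> l" unfolding l_def using d by (subst ln_le_cancel_iff) auto
    finally show ?thesis .
  qed
  have q: "1 \<le> q" using l by (simp add: q_def Suc_le_eq)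
  have ql: "l \<le> real q" "real q \<le> l + 1" using l by (auto simp: q_def)
  \<comment> \<open>Chosen so that its \<open>q\<close>-th root, the value of
    \<open>smooth_max\<close> at the origin, is \<open>\<sigma>\<^sup>2\<close>, the order of the
    cost of one summand.\<close>
  define \<delta> where "\<delta> = (\<sigma>\<^sup>2) powr real q"
  have \<delta>: "0 < \<delta>" using \<sigma> by (simp add: \<delta>_def)
  have \<delta>q: "\<delta> powr (1 / real q) = \<sigma>\<^sup>2" using q \<sigma> by (simp add: \<delta>_def powr_powr)
  have "real CARD('n) powr (1 / real q) = exp (l / real q)"
    using d by (simp add: powr_def l_def)
  also have "\<dots> \<le> exp 1" using q ql by simp
  also have "\<dots> \<le> 3" using exp_le by simp
  finally have e: "real CARD('n) powr (1 / real q) \<le> 3" .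
  have cJ: "1 \<le> real (card J)" using J by (simp add: Suc_le_eq card_gt_0_iff)
  have "(\<integral>\<^sup>+z. ennreal ((infnorm (\<Sum>j\<in>J. h (z j)))\<^sup>2) \<partial>PiM J (\<lambda>_. D))
    \<le> (\<integral>\<^sup>+z. ennreal (smooth_max q \<delta> (\<Sum>j\<in>J. h (z j))) \<partial>PiM J (\<lambda>_. D))"
    using q \<delta> by (intro nn_integral_mono ennreal_leI infnorm_sq_le_smooth_max) auto
  also have "\<dots> \<le> ennreal (\<sigma>\<^sup>2 + real (card J) * ((2 * real q - 1) * real CARD('n) powr (1 / real q) * \<sigma>\<^sup>2))"
    using nn_integral_smooth_max_sum_le[OF D q \<delta> mean var J(1)] by (simp add: \<delta>q)
  \<comment> \<open>The 14 is 12 + 2: \<open>(2 * l + 1) * 3 \<le> 12 * l\<close> for the summands,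
    and \<open>1 \<le> 2 * l * card J\<close> for the offset.\<close>
  also have "\<dots> \<le> ennreal (14 * l * real (card J) * \<sigma>\<^sup>2)"
  proof (rule ennreal_leI)
    have "(2 * real q - 1) * real CARD('n) powr (1 / real q) \<le> (2 * l + 1) * 3"
      using q ql e l by (intro mult_mono) auto
    also have "\<dots> \<le> 12 * l" using l by simp
    finally have "real (card J) * ((2 * real q - 1) * real CARD('n) powr (1 / real q) * \<sigma>\<^sup>2)
        \<le> real (card J) * (12 * l * \<sigma>\<^sup>2)"
      by (intro mult_left_mono mult_right_mono) auto
    moreover have "1 * \<sigma>\<^sup>2 \<le> (real (card J) * (2 * l)) * \<sigma>\<^sup>2"
    proof (rule mult_right_mono)
      have "1 * 1 \<le> real (card J) * (2 * l)" using cJ l by (intro mult_mono) auto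
      then show "1 \<le> real (card J) * (2 * l)" by simp
    qed simp
    ultimately show "\<sigma>\<^sup>2 + real (card J) * ((2 * real q - 1) * real CARD('n) powr (1 / real q) * \<sigma>\<^sup>2)
        \<le> 14 * l * real (card J) * \<sigma>\<^sup>2"
      by (simp add: algebra_simps)
  qed
  finally show ?thesis by (simp add: l_def)
qed

section \<open>Independence and fresh samples\<close>

lemma (in prob_space) indep_rv_prob:
  assumes "indep_rv N1 U N2 V" and A: "A \<in> sets N1" and B: "B \<in> sets N2"
  shows "emeasure M (U -` A \<inter> V -` B \<inter> space M) = emeasure M (U -` A \<inter> space M) * emeasure M (V -` B \<inter> space M)"
proof -
  have ind: "indep_set (sets (vimage_algebra (space M) U N1)) (sets (vimage_algebra (space M) V N2))"
    using assms(1) by (simp add: indep_rv_def)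
  have "prob ((U -` A \<inter> space M) \<inter> (V -` B \<inter> space M)) = prob (U -` A \<inter> space M) * prob (V -` B \<inter> space M)"
    by (rule indep_setD[OF ind]) (intro in_vimage_algebra A B)+
  moreover have "(U -` A \<inter> space M) \<inter> (V -` B \<inter> space M) = U -` A \<inter> V -` B \<inter> space M" by auto
  ultimately show ?thesis by (simp add: emeasure_eq_measure ennreal_mult'')
qed

text \<open>As \<open>U\<close> takes its values in \<open>S\<close>, preimages of trace sets are
  preimages of Borel sets, so the generated events are among those already independent of
  \<open>V\<close>.\<close>

lemma (in prob_space) indep_rv_restrict_space:
  assumes ind: "indep_rv borel U N2 V" and S: "\<And>\<omega>. \<omega> \<in> space M \<Longrightarrow> U \<omega> \<in> S"
  shows "indep_rv (restrict_space borel S) U N2 V"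
proof -
  have U: "U \<in> borel_measurable M" using ind by (simp add: indep_rv_def)
  have US: "U \<in> measurable M (restrict_space borel S)"
    by (rule measurable_restrict_space2) (use S U in auto)
  have sub: "sets (vimage_algebra (space M) U (restrict_space borel S)) \<subseteq> sets (vimage_algebra (space M) U borel)"
  proof
    fix A assume "A \<in> sets (vimage_algebra (space M) U (restrict_space borel S))"
    moreover have "U \<in> space M \<rightarrow> space (restrict_space borel S)"
      using S by (simp add: space_restrict_space)
    ultimately obtain B where "B \<in> sets (restrict_space borel S)" "A = U -` B \<inter> space M"
      by (auto simp: sets_vimage_algebra2)
    then obtain C where C: "C \<in> sets borel" "A = U -` (S \<inter> C) \<inter> space M"
      by (auto simp: sets_restrict_space)
    have "A = U -` C \<inter> space M" using C(2) S by auto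
    then show "A \<in> sets (vimage_algebra (space M) U borel)" using C(1) by (simp add: in_vimage_algebra)
  qed
  have "indep_set (sets (vimage_algebra (space M) U borel)) (sets (vimage_algebra (space M) V N2))"
    using ind by (simp add: indep_rv_def)
  then have "indep_set (sets (vimage_algebra (space M) U (restrict_space borel S))) (sets (vimage_algebra (space M) V N2))"
    unfolding indep_set_def
    by (rule indep_sets_mono_sets) (use sub in \<open>auto split: bool.split\<close>)
  then show ?thesis using US ind by (simp add: indep_rv_def)
qed

lemma (in prob_space) indep_rv_distr_pair:
  assumes ind: "indep_rv N1 U N2 V"
  shows "distr M (N1 \<Otimes>\<^sub>M N2) (\<lambda>\<omega>. (U \<omega>, V \<omega>)) = distr M N1 U \<Otimes>\<^sub>M distr M N2 V"
proof -
  have [measurable]: "U \<in> measurable M N1" "V \<in> measurable M N2"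
    using ind by (auto simp: indep_rv_def)
  interpret U: prob_space "distr M N1 U" by (rule prob_space_distr) measurable
  interpret V: prob_space "distr M N2 V" by (rule prob_space_distr) measurable
  show ?thesis
  proof (rule pair_measure_eqI[symmetric])
    show "sets (distr M N1 U \<Otimes>\<^sub>M distr M N2 V) = sets (distr M (N1 \<Otimes>\<^sub>M N2) (\<lambda>\<omega>. (U \<omega>, V \<omega>)))"
      by (simp cong: sets_pair_measure_cong)
    fix A B assume "A \<in> sets (distr M N1 U)" "B \<in> sets (distr M N2 V)"
    then have A: "A \<in> sets N1" and B: "B \<in> sets N2" by simp_all
    have "emeasure (distr M (N1 \<Otimes>\<^sub>M N2) (\<lambda>\<omega>. (U \<omega>, V \<omega>))) (A \<times> B)
        = emeasure M ((\<lambda>\<omega>. (U \<omega>, V \<omega>)) -` (A \<times> B) \<inter> space M)"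
      using A B by (intro emeasure_distr) auto
    also have "(\<lambda>\<omega>. (U \<omega>, V \<omega>)) -` (A \<times> B) \<inter> space M = U -` A \<inter> V -` B \<inter> space M" by auto
    also have "emeasure M \<dots> = emeasure (distr M N1 U) A * emeasure (distr M N2 V) B"
      using A B by (simp add: indep_rv_prob[OF ind] emeasure_distr)
    finally show "emeasure (distr M N1 U) A * emeasure (distr M N2 V) B
        = emeasure (distr M (N1 \<Otimes>\<^sub>M N2) (\<lambda>\<omega>. (U \<omega>, V \<omega>))) (A \<times> B)" ..
  qed unfold_locales
qed

text \<open>Splitting along the finitely many values of \<open>Y\<close> turns the random choice
  into a sum of products, and independence factors each product. This computes the expectation at
  the randomly drawn output index.\<close>

lemma (in prob_space) nn_integral_indep_index:
  fixes Y :: "'a \<Rightarrow> nat"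
  assumes ind: "indep_rv (count_space UNIV) Y N V" and A: "finite A"
    and Y: "\<And>\<omega>. \<omega> \<in> space M \<Longrightarrow> Y \<omega> \<in> A"
    and h: "\<And>k. k \<in> A \<Longrightarrow> h k \<in> borel_measurable N"
  shows "(\<lambda>\<omega>. h (Y \<omega>) (V \<omega>)) \<in> borel_measurable M"
    and "(\<integral>\<^sup>+\<omega>. h (Y \<omega>) (V \<omega>) \<partial>M)
      = (\<Sum>k\<in>A. emeasure M {\<omega> \<in> space M. Y \<omega> = k} * (\<integral>\<^sup>+\<omega>. h k (V \<omega>) \<partial>M))"
proof -
  have [measurable]: "Y \<in> measurable M (count_space UNIV)" "V \<in> measurable M N"
    using ind by (auto simp: indep_rv_def)
  have eq: "h (Y \<omega>) (V \<omega>) = (\<Sum>k\<in>A. indicator {k} (Y \<omega>) * h k (V \<omega>))" if "\<omega> \<in> space M" for \<omega>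
    using Y[OF that] A by (simp add: indicator_def sum.delta if_distrib[of "\<lambda>c. c * _"] cong: if_cong)
  have m: "(\<lambda>\<omega>. indicator {k} (Y \<omega>) * h k (V \<omega>) :: ennreal) \<in> borel_measurable M" if "k \<in> A" for k
  proof -
    note [measurable] = h[OF that]
    have [measurable]: "{k} \<in> sets (count_space UNIV)" by simp
    show ?thesis by measurable
  qed
  show "(\<lambda>\<omega>. h (Y \<omega>) (V \<omega>)) \<in> borel_measurable M"
    using m by (subst measurable_cong[OF eq]) auto
  interpret V: prob_space "distr M N V" by (rule prob_space_distr) measurable
  have "(\<integral>\<^sup>+\<omega>. h (Y \<omega>) (V \<omega>) \<partial>M) = (\<Sum>k\<in>A. \<integral>\<^sup>+\<omega>. indicator {k} (Y \<omega>) * h k (V \<omega>) \<partial>M)"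
    using m by (subst nn_integral_cong[OF eq]) (auto intro!: nn_integral_sum)
  also have "\<dots> = (\<Sum>k\<in>A. emeasure M {\<omega> \<in> space M. Y \<omega> = k} * (\<integral>\<^sup>+\<omega>. h k (V \<omega>) \<partial>M))"
  proof (rule sum.cong[OF refl])
    fix k assume k: "k \<in> A"
    note [measurable] = h[OF k]
    have "indicator {k} \<in> measurable (count_space UNIV) (borel :: ennreal measure)"
      by simp
    then have mh: "(\<lambda>p. indicator {k} (fst p) * h k (snd p) :: ennreal) \<in> borel_measurable (count_space UNIV \<Otimes>\<^sub>M N)"
      by (intro borel_measurable_times_ennreal measurable_compose[OF measurable_fst] measurable_compose[OF measurable_snd h[OF k]])
    have "(\<integral>\<^sup>+\<omega>. indicator {k} (Y \<omega>) * h k (V \<omega>) \<partial>M)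
      = (\<integral>\<^sup>+p. indicator {k} (fst p) * h k (snd p) \<partial>distr M (count_space UNIV \<Otimes>\<^sub>M N) (\<lambda>\<omega>. (Y \<omega>, V \<omega>)))"
      using mh by (subst nn_integral_distr) simp_all
    also have "\<dots> = (\<integral>\<^sup>+p. indicator {k} (fst p) * h k (snd p) \<partial>(distr M (count_space UNIV) Y \<Otimes>\<^sub>M distr M N V))"
      by (simp add: indep_rv_distr_pair[OF ind])
    also have "\<dots> = (\<integral>\<^sup>+y. \<integral>\<^sup>+v. indicator {k} y * h k v \<partial>distr M N V \<partial>distr M (count_space UNIV) Y)"
      using mh by (subst V.nn_integral_fst[symmetric])
        (simp_all cong: measurable_cong_sets sets_pair_measure_cong)
    also have "\<dots> = (\<integral>\<^sup>+y. indicator {k} y \<partial>distr M (count_space UNIV) Y) * (\<integral>\<^sup>+v. h k v \<partial>distr M N V)"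
      by (simp add: nn_integral_cmult nn_integral_multc)
    also have "(\<integral>\<^sup>+y. indicator {k} y \<partial>distr M (count_space UNIV) Y) = emeasure M {\<omega> \<in> space M. Y \<omega> = k}"
      by (simp add: emeasure_distr vimage_def Int_def conj_commute)
    also have "(\<integral>\<^sup>+v. h k v \<partial>distr M N V) = (\<integral>\<^sup>+\<omega>. h k (V \<omega>) \<partial>M)"
      by (simp add: nn_integral_distr)
    finally show "(\<integral>\<^sup>+\<omega>. indicator {k} (Y \<omega>) * h k (V \<omega>) \<partial>M)
      = emeasure M {\<omega> \<in> space M. Y \<omega> = k} * (\<integral>\<^sup>+\<omega>. h k (V \<omega>) \<partial>M)" .
  qed
  finally show "(\<integral>\<^sup>+\<omega>. h (Y \<omega>) (V \<omega>) \<partial>M)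
      = (\<Sum>k\<in>A. emeasure M {\<omega> \<in> space M. Y \<omega> = k} * (\<integral>\<^sup>+\<omega>. h k (V \<omega>) \<partial>M))" .
qed

text \<open>Tonelli with the block \<open>B\<close> innermost. A bound on the inner integral that is
  uniform in \<open>u\<close> and the other coordinates survives, because the outer measures are
  probabilities; this plays the role of conditioning on the past.\<close>

lemma nn_integral_fresh_le:
  assumes D: "prob_space D" and N: "prob_space N" and I: "finite I" "B \<subseteq> I"
    and H: "H \<in> borel_measurable (N \<Otimes>\<^sub>M PiM I (\<lambda>_. D))"
    and le: "\<And>u z. u \<in> space N \<Longrightarrow> z \<in> space (PiM (I - B) (\<lambda>_. D)) \<Longrightarrow>
      (\<integral>\<^sup>+z'. H (u, merge (I - B) B (z, z')) \<partial>PiM B (\<lambda>_. D)) \<le> c"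
  shows "(\<integral>\<^sup>+p. H p \<partial>(N \<Otimes>\<^sub>M PiM I (\<lambda>_. D))) \<le> c"
proof -
  interpret N: prob_space N by fact
  interpret P: product_prob_space "\<lambda>_. D" by (intro product_prob_spaceI D)
  interpret PI: prob_space "PiM I (\<lambda>_. D)" using D by (intro prob_space_PiM)
  interpret PB: prob_space "PiM (I - B) (\<lambda>_. D)" using D by (intro prob_space_PiM)
  have fin: "finite (I - B)" "finite B" using I finite_subset by auto
  have "(\<integral>\<^sup>+p. H p \<partial>(N \<Otimes>\<^sub>M PiM I (\<lambda>_. D))) = (\<integral>\<^sup>+u. \<integral>\<^sup>+z. H (u, z) \<partial>PiM I (\<lambda>_. D) \<partial>N)"
    by (rule sigma_finite_measure.nn_integral_fst[OF _ H, symmetric]) unfold_locales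
  also have "\<dots> \<le> (\<integral>\<^sup>+u. c \<partial>N)"
  proof (rule nn_integral_mono)
    fix u assume u: "u \<in> space N"
    have I_eq: "(I - B) \<union> B = I" using I by auto
    have Hu: "(\<lambda>z. H (u, z)) \<in> borel_measurable (PiM I (\<lambda>_. D))"
      using measurable_compose[OF measurable_Pair1'[OF u] H] by simp
    have "(\<integral>\<^sup>+z. H (u, z) \<partial>PiM I (\<lambda>_. D))
      = (\<integral>\<^sup>+z. \<integral>\<^sup>+z'. H (u, merge (I - B) B (z, z')) \<partial>PiM B (\<lambda>_. D) \<partial>PiM (I - B) (\<lambda>_. D))"
      using P.product_nn_integral_fold[of "I - B" B "\<lambda>z. H (u, z)"] fin Hu I_eq by auto
    also have "\<dots> \<le> (\<integral>\<^sup>+z. c \<partial>PiM (I - B) (\<lambda>_. D))"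
      by (intro nn_integral_mono le u)
    also have "\<dots> = c" by (simp add: PB.emeasure_space_1)
    finally show "(\<integral>\<^sup>+z. H (u, z) \<partial>PiM I (\<lambda>_. D)) \<le> c" .
  qed
  also have "\<dots> = c" by (simp add: N.emeasure_space_1)
  finally show ?thesis .
qed

text \<open>Indices are shifted by one: the value at \<open>k\<close> stands for the iterate
  \<open>x (k + 1)\<close>, and the step leaving state \<open>k\<close> reads batch
  \<open>k + 1\<close>.\<close>

primrec iter_map :: "('a \<Rightarrow> (nat \<Rightarrow> 'z) \<Rightarrow> 'a) \<Rightarrow> 'a \<Rightarrow> (nat \<times> nat \<Rightarrow> 'z) \<Rightarrow> nat \<Rightarrow> 'a" where
  "iter_map T u z 0 = u"
| "iter_map T u z (Suc k) = T (iter_map T u z k) (\<lambda>i. z (Suc k, i))"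

text \<open>Adaptedness of the iterates: batches after the \<open>k\<close>-th do not enter, which
  is what makes the next batch fresh.\<close>

lemma iter_map_cong:
  assumes "\<And>j i. j \<le> k \<Longrightarrow> z (j, i) = z' (j, i)"
  shows "iter_map T u z k = iter_map T u z' k"
  using assms by (induction k) auto

text \<open>\<open>T\<close> receives a batch indexed by all natural numbers, but only indices up to
  \<open>m\<close> are coordinates of the product. Hence the measurability of \<open>T\<close> is
  assumed in terms of compositions rather than over a product sigma-algebra.\<close>

lemma measurable_iter_map:
  fixes N :: "'a measure" and D :: "'z measure"
  assumes T: "\<And>N' v b. v \<in> measurable N' N \<Longrightarrow> (\<And>i. i \<in> {1..m} \<Longrightarrow> (\<lambda>w. b w i) \<in> measurable N' D) \<Longrightarrow>
      (\<lambda>w. T (v w) (b w)) \<in> measurable (N' :: ('a \<times> (nat \<times> nat \<Rightarrow> 'z)) measure) N"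
    and k: "k \<le> K"
  shows "(\<lambda>(u, z). iter_map T u z k) \<in> measurable (N \<Otimes>\<^sub>M PiM (SIGMA k:{1..K}. {1..m}) (\<lambda>_. D)) N"
  using k
proof (induction k)
  case (Suc k)
  have "(\<lambda>p. T (case p of (u, z) \<Rightarrow> iter_map T u z k) (\<lambda>i. snd p (Suc k, i)))
      \<in> measurable (N \<Otimes>\<^sub>M PiM (SIGMA k:{1..K}. {1..m}) (\<lambda>_. D)) N"
  proof (rule T)
    show "(\<lambda>(u, z). iter_map T u z k) \<in> measurable (N \<Otimes>\<^sub>M PiM (SIGMA k:{1..K}. {1..m}) (\<lambda>_. D)) N"
      using Suc by simp
    fix i assume "i \<in> {1..m}"
    then have "(Suc k, i) \<in> (SIGMA k:{1..K}. {1..m})" using Suc.prems by auto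
    from measurable_component_singleton[OF this]
    show "(\<lambda>w. snd w (Suc k, i)) \<in> measurable (N \<Otimes>\<^sub>M PiM (SIGMA k:{1..K}. {1..m}) (\<lambda>_. D)) D"
      by (rule measurable_compose[OF measurable_snd])
  qed
  then show ?case by (simp add: case_prod_beta)
qed simp

section \<open>One step of the method\<close>

lemma infnorm_le_l1norm:
  fixes x :: "real ^ 'n"
  shows "infnorm x \<le> l1norm x"
  unfolding infnorm_le_iff l1norm_def
  using member_le_sum[of _ UNIV "\<lambda>i. \<bar>x $ i\<bar>"] by simp

text \<open>In the factor \<open>\<rho> + 2\<close>, the \<open>\<rho>\<close> comes from the
  proximal term, one unit from the Euclidean term and one from the change of the gradient between
  \<open>x\<close> and \<open>x'\<close>. In the factor \<open>\<rho> - 1\<close>, the sharper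
  second part of \<open>prox_step_variational\<close> supplies \<open>\<rho>\<close>; half a unit is
  lost to the descent inequality and half to splitting \<open>w * d\<close> by Young's
  inequality.\<close>

lemma prox_step_bounds:
  fixes X :: "(real ^ 'n) set"
  assumes conv: "convex X" and der: "\<And>u. GDERIV f u :> gradf u"
    and smooth: "\<And>u v. u \<in> X \<Longrightarrow> v \<in> X \<Longrightarrow> infnorm (gradf u - gradf v) \<le> L * l1norm (u - v)"
    and L: "0 < L" and \<rho>: "0 \<le> \<rho>" and x: "x \<in> X"
    and step: "prox_step X (\<lambda>u. \<rho> / 2 * (l1norm u)\<^sup>2) (1 / L) g x x'"
  defines "w \<equiv> infnorm (g - gradf x)" and "d \<equiv> l1norm (x' - x)"
  shows "dist0_inf (frechet_subdiff (\<lambda>y. ereal (f y) + set_ind X y) x') \<le> ennreal ((\<rho> + 2) * L * d + w)"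
    and "f x' + (\<rho> - 1) * L * d\<^sup>2 \<le> f x + w\<^sup>2 / (2 * L)"
proof -
  have x': "x' \<in> X" using step unfolding prox_step_iff by simp
  have d: "0 \<le> d" unfolding d_def by (rule l1norm_nonneg)
  have w: "0 \<le> w" unfolding w_def by (rule infnorm_pos_le)
  have R: "0 \<le> (\<rho> + 2) * L * d + w" using \<rho> L d w by simp
  show "dist0_inf (frechet_subdiff (\<lambda>y. ereal (f y) + set_ind X y) x') \<le> ennreal ((\<rho> + 2) * L * d + w)"
    unfolding dist0_inf_subdiff_le_iff[OF conv der R]
  proof (intro conjI ballI)
    fix y assume y: "y \<in> X"
    define z where "z = y - x'"
    have zn: "0 \<le> l1norm z" by (rule l1norm_nonneg)
    have "0 \<le> (x' - x + (1 / L) *\<^sub>R g) \<bullet> z + \<rho> * d * l1norm z"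
      unfolding z_def d_def by (rule prox_step_variational(1)[OF conv x \<rho> step y])
    then have "0 \<le> L * ((x' - x + (1 / L) *\<^sub>R g) \<bullet> z + \<rho> * d * l1norm z)"
      using L by simp
    then have 1: "0 \<le> L * ((x' - x) \<bullet> z) + g \<bullet> z + \<rho> * L * d * l1norm z"
      using L by (simp add: inner_add_left algebra_simps)
    have ab: "a \<bullet> z \<le> c * l1norm z" if "infnorm a \<le> c" for a c
      using inner_le_infnorm_l1norm[of a z] mult_right_mono[OF that zn] by linarith
    have "(x' - x) \<bullet> z \<le> d * l1norm z"
      by (rule ab) (simp add: d_def infnorm_le_l1norm)
    then have 2: "L * ((x' - x) \<bullet> z) \<le> L * (d * l1norm z)" using L by simp
    have 3: "(gradf x - gradf x') \<bullet> z \<le> (L * d) * l1norm z"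
      by (rule ab) (use smooth[OF x x'] in \<open>simp add: d_def l1norm_minus_commute\<close>)
    have 4: "(g - gradf x) \<bullet> z \<le> w * l1norm z" by (rule ab) (simp add: w_def)
    have "((\<rho> + 2) * L * d + w) * l1norm z
        = \<rho> * L * d * l1norm z + L * (d * l1norm z) + (L * d) * l1norm z + w * l1norm z"
      by (simp add: algebra_simps)
    with 1 2 3 4 show "0 \<le> gradf x' \<bullet> (y - x') + ((\<rho> + 2) * L * d + w) * l1norm (y - x')"
      unfolding z_def[symmetric] inner_diff_left by linarith
  qed (rule x')
  have "(x' - x + (1 / L) *\<^sub>R g) \<bullet> (x' - x) \<le> - \<rho> * d\<^sup>2"
    unfolding d_def by (rule prox_step_variational(2)[OF conv x \<rho> step])
  then have "(1 / L) * (g \<bullet> (x' - x)) \<le> - \<rho> * d\<^sup>2"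
    using inner_ge_zero[of "x' - x"] unfolding inner_add_left inner_scaleR_left by linarith
  then have 1: "g \<bullet> (x' - x) \<le> - \<rho> * L * d\<^sup>2" using L by (simp add: field_simps)
  have "- ((g - gradf x) \<bullet> (x' - x)) \<le> w * d"
    using inner_le_infnorm_l1norm[of "g - gradf x" "x' - x"] by (simp add: w_def d_def)
  also have "\<dots> \<le> w\<^sup>2 / (2 * L) + L / 2 * d\<^sup>2"
  proof -
    have "0 \<le> (w - L * d)\<^sup>2 / (2 * L)" using L by simp
    also have "\<dots> = w\<^sup>2 / (2 * L) + L / 2 * d\<^sup>2 - w * d"
      using L by (simp add: power2_eq_square field_simps)
    finally show ?thesis by simp
  qed
  finally have "gradf x \<bullet> (x' - x) \<le> g \<bullet> (x' - x) + w\<^sup>2 / (2 * L) + L / 2 * d\<^sup>2"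
    by (simp add: inner_diff_left)
  with 1 descent_l1norm[OF conv der smooth x x']
  show "f x' + (\<rho> - 1) * L * d\<^sup>2 \<le> f x + w\<^sup>2 / (2 * L)"
    unfolding d_def[symmetric] left_diff_distrib by simp
qed

text \<open>Averaging contributes \<open>1 / m\<^sup>2\<close> against a second moment of the sum
  that grows linearly in \<open>m\<close>. The batch is indexed by
  \<open>{k} \<times> {1..m}\<close>, the block that \<open>nn_integral_fresh_le\<close>
  isolates.\<close>

lemma nn_integral_minibatch_error_le:
  fixes G :: "real ^ 'n \<Rightarrow> 'z \<Rightarrow> real ^ 'n"
  assumes D: "prob_space D" and d: "2 \<le> CARD('n)" and \<sigma>: "0 < \<sigma>\<^sup>2" and m: "1 \<le> m"
    and mean: "has_bochner_integral D (G u) g"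
    and var: "(\<integral>\<^sup>+z. ennreal ((infnorm (G u z - g))\<^sup>2) \<partial>D) \<le> ennreal (\<sigma>\<^sup>2)"
  shows "(\<integral>\<^sup>+z. ennreal ((infnorm (minibatch G m u (\<lambda>i. z (k, i)) - g))\<^sup>2) \<partial>PiM ({k} \<times> {1..m}) (\<lambda>_. D))
    \<le> ennreal (14 * ln (real CARD('n)) * \<sigma>\<^sup>2 / real m)"
proof -
  interpret prob_space D by fact
  let ?J = "{k} \<times> {1..m}"
  let ?P = "PiM ?J (\<lambda>_. D)"
  let ?h = "\<lambda>y. G u y - g"
  have h0: "has_bochner_integral D ?h 0"
    using mean by (auto simp: has_bochner_integral_iff prob_space)
  then have h_meas: "?h \<in> borel_measurable D" by (auto simp: has_bochner_integral_iff)
  have hz: "(\<lambda>z. ?h (z j)) \<in> borel_measurable ?P" if "j \<in> ?J" for j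
    by (rule measurable_compose[OF measurable_component_singleton[OF that] h_meas])
  have err: "minibatch G m u (\<lambda>i. z (k, i)) - g = (1 / real m) *\<^sub>R (\<Sum>j\<in>?J. ?h (z j))" for z
  proof -
    have "(\<Sum>j\<in>?J. ?h (z j)) = (\<Sum>i=1..m. ?h (z (k, i)))"
      by (rule sum.reindex_bij_witness[of _ "\<lambda>i. (k, i)" snd]) auto
    also have "\<dots> = (\<Sum>i=1..m. G u (z (k, i))) - real m *\<^sub>R g"
      by (simp only: sum_subtractf sum_constant_scaleR card_atLeastAtMost) simp
    finally show ?thesis using m by (simp add: minibatch_def scaleR_diff_right)
  qed
  have "(\<integral>\<^sup>+z. ennreal ((infnorm (minibatch G m u (\<lambda>i. z (k, i)) - g))\<^sup>2) \<partial>?P)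
    = (\<integral>\<^sup>+z. ennreal ((1 / real m)\<^sup>2) * ennreal ((infnorm (\<Sum>j\<in>?J. ?h (z j)))\<^sup>2) \<partial>?P)"
    unfolding err infnorm_mul power_mult_distrib power2_abs by (simp only: ennreal_mult' zero_le_power2)
  also have "\<dots> = ennreal ((1 / real m)\<^sup>2) * (\<integral>\<^sup>+z. ennreal ((infnorm (\<Sum>j\<in>?J. ?h (z j)))\<^sup>2) \<partial>?P)"
    by (intro nn_integral_cmult measurable_compose[OF _ measurable_ennreal] borel_measurable_power
        measurable_compose[OF _ borel_measurable_infnorm] borel_measurable_sum hz)
  also have "\<dots> \<le> ennreal ((1 / real m)\<^sup>2) * ennreal (14 * ln (real CARD('n)) * real (card ?J) * \<sigma>\<^sup>2)"
    using m by (intro mult_left_mono nn_integral_infnorm_sum_sq_le[OF D d \<sigma> h0 var]) auto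
  also have "\<dots> = ennreal (14 * ln (real CARD('n)) * \<sigma>\<^sup>2 / real m)"
    using m by (simp add: ennreal_mult'[symmetric] power2_eq_square card_cartesian_product)
  finally show ?thesis .
qed

lemma measurable_minibatch:
  fixes G :: "'b \<Rightarrow> 'z \<Rightarrow> 'b :: euclidean_space"
  assumes G: "(\<lambda>(u, z). G u z) \<in> borel_measurable (S \<Otimes>\<^sub>M D)"
    and v: "v \<in> measurable N S" and b: "\<And>i. i \<in> {1..m} \<Longrightarrow> (\<lambda>w. b w i) \<in> measurable N D"
  shows "(\<lambda>w. minibatch G m (v w) (b w)) \<in> borel_measurable N"
proof -
  have "(\<lambda>w. G (v w) (b w i)) \<in> borel_measurable N" if "i \<in> {1..m}" for i
    using measurable_compose[OF measurable_Pair[OF v b[OF that]] G] by simp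
  then show ?thesis unfolding minibatch_def by (intro borel_measurable_scaleR borel_measurable_const borel_measurable_sum)
qed

lemma minibatch_cong:
  "(\<And>i. i \<in> {1..m} \<Longrightarrow> z i = z' i) \<Longrightarrow> minibatch G m u z = minibatch G m u z'"
  by (simp add: minibatch_def)

text \<open>The iterate \<open>x k\<close> is a measurable function of \<open>x 1\<close> and the batches before the \<open>k\<close>-th, so the
  integral over the \<open>k\<close>-th batch can be taken first, with \<open>x k\<close> held fixed.\<close>

lemma nn_integral_gradient_error_le:
  fixes X :: "(real ^ 'n) set" and \<zeta> :: "nat \<Rightarrow> nat \<Rightarrow> 'w \<Rightarrow> 'z"
  assumes X: "closed X" "convex X" and D: "prob_space D" and M: "prob_space M"
    and cont: "continuous_on X gradf"
    and G_meas: "(\<lambda>(u, z). G u z) \<in> borel_measurable (restrict_space borel X \<Otimes>\<^sub>M D)"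
    and mean: "\<And>u. u \<in> X \<Longrightarrow> has_bochner_integral D (G u) (gradf u)"
    and var: "\<And>u. u \<in> X \<Longrightarrow> (\<integral>\<^sup>+z. ennreal ((infnorm (G u z - gradf u))\<^sup>2) \<partial>D) \<le> ennreal (\<sigma>\<^sup>2)"
    and \<rho>: "0 \<le> \<rho>" and d: "2 \<le> CARD('n)" and \<sigma>: "0 < \<sigma>\<^sup>2" and m: "1 \<le> m"
    and x1_in: "\<And>\<omega>. \<omega> \<in> space M \<Longrightarrow> x 1 \<omega> \<in> X"
    and law: "\<And>k i. k \<in> {1..K} \<Longrightarrow> i \<in> {1..m} \<Longrightarrow> distr M D (\<zeta> k i) = D"
    and ind: "prob_space.indep_vars M (\<lambda>_. D) (\<lambda>(k, i). \<zeta> k i) (SIGMA k:{1..K}. {1..m})"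
    and ind1: "prob_space.indep_rv M borel (x 1) (PiM (SIGMA k:{1..K}. {1..m}) (\<lambda>_. D))
         (\<lambda>\<omega>. \<lambda>(k, i)\<in>(SIGMA k:{1..K}. {1..m}). \<zeta> k i \<omega>)"
    and step: "\<And>k \<omega>. k \<in> {1..K} \<Longrightarrow> \<omega> \<in> space M \<Longrightarrow>
         prox_step X (\<lambda>u. \<rho> / 2 * (l1norm u)\<^sup>2) \<eta>
           (minibatch G m (x k \<omega>) (\<lambda>i. \<zeta> k i \<omega>)) (x k \<omega>) (x (k + 1) \<omega>)"
    and k: "k \<in> {1..K}"
  defines "w \<equiv> \<lambda>\<omega>. infnorm (minibatch G m (x k \<omega>) (\<lambda>i. \<zeta> k i \<omega>) - gradf (x k \<omega>))"
  shows "w \<in> borel_measurable M"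
    and "(\<integral>\<^sup>+\<omega>. ennreal ((w \<omega>)\<^sup>2) \<partial>M) \<le> ennreal (14 * ln (real CARD('n)) * \<sigma>\<^sup>2 / real m)"
proof -
  interpret M: prob_space M by fact
  define I where "I = (SIGMA k:{1..K}. {1..m})"
  define S where "S = restrict_space borel X"
  define P where "P = PiM I (\<lambda>_. D)"
  define Z where "Z = (\<lambda>\<omega>. \<lambda>(k, i)\<in>I. \<zeta> k i \<omega>)"
  define T where "T = (\<lambda>u b. prox_map X \<rho> \<eta> u (minibatch G m u b))"
  have spS: "space S = X" by (simp add: S_def space_restrict_space)
  have finI: "finite I" by (simp add: I_def)
  have in_I: "(j, i) \<in> I \<longleftrightarrow> j \<in> {1..K} \<and> i \<in> {1..m}" for j i by (simp add: I_def)
  have Zval: "Z \<omega> (j, i) = \<zeta> j i \<omega>" if "j \<in> {1..K}" "i \<in> {1..m}" for j i \<omega>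
    using that by (simp add: Z_def in_I del: atLeastAtMost_iff)
  have T_in: "T u b \<in> X" if "u \<in> X" for u b
    using prox_step_prox_map[OF X(1) that \<rho>] unfolding T_def prox_step_iff by blast
  have iter_in: "iter_map T u z j \<in> X" if "u \<in> X" for u z j
    by (induction j) (auto intro: that T_in)
  \<comment> \<open>Uniqueness of the step identifies the given iterates with the selected ones,
    outcome by outcome.\<close>
  have x_eq: "x (Suc j) \<omega> = iter_map T (x 1 \<omega>) (Z \<omega>) j" if \<omega>: "\<omega> \<in> space M" and "j \<le> K" for j \<omega>
    using \<open>j \<le> K\<close>
  proof (induction j)
    case (Suc j)
    then have IH: "x (Suc j) \<omega> = iter_map T (x 1 \<omega>) (Z \<omega>) j" and j: "Suc j \<in> {1..K}" by auto
    have "minibatch G m (x (Suc j) \<omega>) (\<lambda>i. \<zeta> (Suc j) i \<omega>) = minibatch G m (x (Suc j) \<omega>) (\<lambda>i. Z \<omega> (Suc j, i))"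
      by (intro minibatch_cong) (rule Zval[OF j, symmetric])
    then have 1: "prox_step X (\<lambda>u. \<rho> / 2 * (l1norm u)\<^sup>2) \<eta> (minibatch G m (x (Suc j) \<omega>) (\<lambda>i. Z \<omega> (Suc j, i)))
        (x (Suc j) \<omega>) (x (Suc (Suc j)) \<omega>)"
      using step[OF j \<omega>] by simp
    have xX: "x (Suc j) \<omega> \<in> X" unfolding IH by (intro iter_in x1_in \<omega>)
    show ?case
      using prox_step_unique[OF X(2) \<rho> 1 prox_step_prox_map[OF X(1) xX \<rho>]] by (simp add: T_def IH)
  qed simp
  have x_S: "x 1 \<in> measurable M S"
    unfolding S_def using ind1 x1_in
    by (intro measurable_restrict_space2) (auto simp: M.indep_rv_def)
  have ind1': "M.indep_rv S (x 1) P Z"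
    unfolding S_def P_def Z_def I_def by (rule M.indep_rv_restrict_space[OF ind1 x1_in])
  have Z_P: "Z \<in> measurable M P" using ind1' by (simp add: M.indep_rv_def)
  have \<zeta>_meas: "\<zeta> j i \<in> measurable M D" if "j \<in> {1..K}" "i \<in> {1..m}" for j i
    using ind that unfolding M.indep_vars_def by fastforce
  have ne: "I \<noteq> {}" using m k by (auto simp: I_def)
  have "distr M P Z = PiM I (\<lambda>p. distr M D (case p of (k, i) \<Rightarrow> \<zeta> k i))"
  proof -
    have "distr M (PiM I (\<lambda>_. D)) (\<lambda>\<omega>. \<lambda>p\<in>I. (case p of (k, i) \<Rightarrow> \<zeta> k i) \<omega>)
        = PiM I (\<lambda>p. distr M D (case p of (k, i) \<Rightarrow> \<zeta> k i))"
      using M.indep_vars_iff_distr_eq_PiM'[OF ne, where M' = "\<lambda>_. D" and X = "\<lambda>(k, i). \<zeta> k i"] \<zeta>_meas ind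
      by (auto simp: I_def)
    moreover have "(\<lambda>\<omega>. \<lambda>p\<in>I. (case p of (k, i) \<Rightarrow> \<zeta> k i) \<omega>) = Z"
      by (auto simp: Z_def fun_eq_iff restrict_def split: prod.split)
    ultimately show ?thesis by (simp add: P_def)
  qed
  also have "\<dots> = P" unfolding P_def by (rule PiM_cong) (auto simp: in_I law)
  finally have Z_law: "distr M P Z = P" .
  have joint: "distr M (S \<Otimes>\<^sub>M P) (\<lambda>\<omega>. (x 1 \<omega>, Z \<omega>)) = distr M S (x 1) \<Otimes>\<^sub>M P"
    using M.indep_rv_distr_pair[OF ind1'] by (simp add: Z_law)
  have iter_meas: "(\<lambda>(u, z). iter_map T u z j) \<in> measurable (S \<Otimes>\<^sub>M P) S" if "j \<le> K" for j
    unfolding P_def I_def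
  proof (rule measurable_iter_map[OF _ that])
    fix N' :: "((real ^ 'n) \<times> (nat \<times> nat \<Rightarrow> 'z)) measure" and v and b :: "_ \<Rightarrow> nat \<Rightarrow> 'z"
    assume v: "v \<in> measurable N' S" and b: "\<And>i. i \<in> {1..m} \<Longrightarrow> (\<lambda>w. b w i) \<in> measurable N' D"
    show "(\<lambda>w. T (v w) (b w)) \<in> measurable N' S"
      unfolding T_def S_def
      by (rule measurable_prox_map[OF X \<rho> v[unfolded S_def] measurable_minibatch[OF G_meas v[unfolded S_def] b]])
  qed
  have grad_S: "gradf \<in> borel_measurable S"
    unfolding S_def by (rule borel_measurable_continuous_on_restrict[OF cont])
  \<comment> \<open>The iterate \<open>x k\<close> is \<open>iter_map\<close> at \<open>j\<close>,
    which reads batches up to \<open>j\<close> only and so misses the block of batch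
    \<open>k\<close>.\<close>
  obtain j where j: "k = Suc j" "j \<le> K" "Suc j \<in> {1..K}" using k by (cases k) auto
  define e where "e = (\<lambda>(u, z). infnorm (minibatch G m (iter_map T u z j) (\<lambda>i. z (k, i)) - gradf (iter_map T u z j)))"
  have e_meas: "e \<in> borel_measurable (S \<Otimes>\<^sub>M P)"
  proof -
    have "(\<lambda>p. minibatch G m (case p of (u, z) \<Rightarrow> iter_map T u z j) (\<lambda>i. snd p (k, i))) \<in> borel_measurable (S \<Otimes>\<^sub>M P)"
    proof (rule measurable_minibatch[OF G_meas[folded S_def] iter_meas[OF j(2)]])
      fix i assume "i \<in> {1..m}"
      then have "(k, i) \<in> I" using k by (simp add: in_I)
      from measurable_component_singleton[OF this]
      show "(\<lambda>w. snd w (k, i)) \<in> measurable (S \<Otimes>\<^sub>M P) D"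
        unfolding P_def by (rule measurable_compose[OF measurable_snd])
    qed
    then have "(\<lambda>p. infnorm (minibatch G m (case p of (u, z) \<Rightarrow> iter_map T u z j) (\<lambda>i. snd p (k, i))
        - gradf (case p of (u, z) \<Rightarrow> iter_map T u z j))) \<in> borel_measurable (S \<Otimes>\<^sub>M P)"
      by (intro measurable_compose[OF _ borel_measurable_infnorm] borel_measurable_diff
          measurable_compose[OF iter_meas[OF j(2)] grad_S])
    then show ?thesis by (simp add: e_def case_prod_beta')
  qed
  have w_eq: "w \<omega> = e (x 1 \<omega>, Z \<omega>)" if \<omega>: "\<omega> \<in> space M" for \<omega>
  proof -
    have "minibatch G m (x k \<omega>) (\<lambda>i. \<zeta> k i \<omega>) = minibatch G m (x k \<omega>) (\<lambda>i. Z \<omega> (k, i))"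
      by (intro minibatch_cong) (rule Zval[OF k, symmetric])
    then show ?thesis using x_eq[OF \<omega> j(2)] by (simp add: w_def e_def j(1))
  qed
  have xZ: "(\<lambda>\<omega>. (x 1 \<omega>, Z \<omega>)) \<in> measurable M (S \<Otimes>\<^sub>M P)" using x_S Z_P by (rule measurable_Pair)
  show "w \<in> borel_measurable M"
    using measurable_compose[OF xZ e_meas] by (subst measurable_cong[OF w_eq])
  define H where "H = (\<lambda>p. ennreal ((e p)\<^sup>2))"
  have H_meas: "H \<in> borel_measurable (S \<Otimes>\<^sub>M P)" unfolding H_def using e_meas by measurable
  have "(\<integral>\<^sup>+\<omega>. ennreal ((w \<omega>)\<^sup>2) \<partial>M) = (\<integral>\<^sup>+\<omega>. H (x 1 \<omega>, Z \<omega>) \<partial>M)"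
    by (rule nn_integral_cong) (simp add: w_eq H_def)
  also have "\<dots> = (\<integral>\<^sup>+p. H p \<partial>(distr M S (x 1) \<Otimes>\<^sub>M P))"
    unfolding joint[symmetric] by (rule nn_integral_distr[symmetric, OF xZ]) (use H_meas in simp)
  also have "\<dots> \<le> ennreal (14 * ln (real CARD('n)) * \<sigma>\<^sup>2 / real m)"
    unfolding P_def
  proof (rule nn_integral_fresh_le[OF D M.prob_space_distr[OF x_S] finI, of "{k} \<times> {1..m}"])
    show "{k} \<times> {1..m} \<subseteq> I" using k by (auto simp: in_I)
    show "H \<in> borel_measurable (distr M S (x 1) \<Otimes>\<^sub>M PiM I (\<lambda>_. D))"
      using H_meas by (simp add: P_def cong: measurable_cong_sets sets_pair_measure_cong)
    fix u z assume u: "u \<in> space (distr M S (x 1))" and z: "z \<in> space (PiM (I - {k} \<times> {1..m}) (\<lambda>_. D))"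
    define v where "v = iter_map T u z j"
    have v: "v \<in> X" unfolding v_def using u by (intro iter_in) (simp add: spS)
    have "H (u, merge (I - {k} \<times> {1..m}) ({k} \<times> {1..m}) (z, z'))
        = ennreal ((infnorm (minibatch G m v (\<lambda>i. z' (k, i)) - gradf v))\<^sup>2)" for z'
    proof -
      let ?z = "merge (I - {k} \<times> {1..m}) ({k} \<times> {1..m}) (z, z')"
      have "iter_map T u ?z j = v"
        unfolding v_def
      proof (rule iter_map_cong)
        fix l i assume "l \<le> j"
        then have "(l, i) \<notin> {k} \<times> {1..m}" using j(1) by auto
        \<comment> \<open>Indices outside \<open>I\<close> occur here as well; there
          \<open>merge\<close> is \<open>undefined\<close>, and so is \<open>z\<close>, being
          extensional.\<close>
        then show "?z (l, i) = z (l, i)"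
          using z by (auto simp: merge_def space_PiM PiE_def extensional_def)
      qed
      moreover have "minibatch G m v (\<lambda>i. ?z (k, i)) = minibatch G m v (\<lambda>i. z' (k, i))"
        by (rule minibatch_cong) (auto simp: merge_def)
      ultimately show ?thesis by (simp add: H_def e_def)
    qed
    then show "(\<integral>\<^sup>+z'. H (u, merge (I - {k} \<times> {1..m}) ({k} \<times> {1..m}) (z, z')) \<partial>PiM ({k} \<times> {1..m}) (\<lambda>_. D))
        \<le> ennreal (14 * ln (real CARD('n)) * \<sigma>\<^sup>2 / real m)"
      using nn_integral_minibatch_error_le[where G = G and u = v, OF D d \<sigma> m mean[OF v] var[OF v]] by simp
  qed
  finally show "(\<integral>\<^sup>+\<omega>. ennreal ((w \<omega>)\<^sup>2) \<partial>M) \<le> ennreal (14 * ln (real CARD('n)) * \<sigma>\<^sup>2 / real m)" .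
qed

section \<open>Complexity of the method\<close>

text \<open>A ceiling is at most twice its argument once the argument is at least 1, but near 0 it
  is not bounded by any fixed multiple; hence the set under the principal filter. The constant
  \<open>4 * (exp 1)\<^sup>2\<close> is two such factors times the \<open>e\<^sup>2\<close> of the
  batch size, uniformly in all parameters.\<close>

lemma sample_complexity_bigo:
  "(\<lambda>(\<Delta>, L, d, \<sigma>, \<epsilon>). real_of_int (\<lceil>\<Delta> * L / \<epsilon>\<^sup>2\<rceil> * \<lceil>(exp 1)\<^sup>2 * ln (real d) * \<sigma>\<^sup>2 / \<epsilon>\<^sup>2\<rceil>))
    \<in> O[principal {(\<Delta>, L, d :: nat, \<sigma>, \<epsilon>).
           1 \<le> \<Delta> * L / \<epsilon>\<^sup>2 \<and> 1 \<le> (exp 1)\<^sup>2 * ln (real d) * \<sigma>\<^sup>2 / \<epsilon>\<^sup>2}](\<lambda>(\<Delta>, L, d, \<sigma>, \<epsilon>). \<Delta> * L * ln (real d) * \<sigma>\<^sup>2 / \<epsilon> ^ 4)"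
proof (rule bigoI[where c = "4 * (exp 1)\<^sup>2"], unfold eventually_principal, clarify)
  fix \<Delta> L \<sigma> \<epsilon> :: real and d :: nat
  define p where "p = \<Delta> * L / \<epsilon>\<^sup>2"
  define q where "q = (exp 1)\<^sup>2 * ln (real d) * \<sigma>\<^sup>2 / \<epsilon>\<^sup>2"
  assume "1 \<le> \<Delta> * L / \<epsilon>\<^sup>2" "1 \<le> (exp 1)\<^sup>2 * ln (real d) * \<sigma>\<^sup>2 / \<epsilon>\<^sup>2"
  then have pq: "1 \<le> p" "1 \<le> q" by (simp_all add: p_def q_def)
  then have c: "0 \<le> real_of_int \<lceil>p\<rceil>" "real_of_int \<lceil>p\<rceil> \<le> 2 * p" "0 \<le> real_of_int \<lceil>q\<rceil>" "real_of_int \<lceil>q\<rceil> \<le> 2 * q"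
    by linarith+
  have "norm (real_of_int (\<lceil>p\<rceil> * \<lceil>q\<rceil>)) = real_of_int \<lceil>p\<rceil> * real_of_int \<lceil>q\<rceil>"
    using c by simp
  also have "\<dots> \<le> 2 * p * (2 * q)" using c pq by (intro mult_mono) auto
  also have "\<dots> = 4 * (exp 1)\<^sup>2 * (\<Delta> * L * ln (real d) * \<sigma>\<^sup>2 / \<epsilon> ^ 4)"
    by (simp add: p_def q_def power2_eq_square power4_eq_xxxx mult_ac)
  also have "\<dots> \<le> 4 * (exp 1)\<^sup>2 * norm (\<Delta> * L * ln (real d) * \<sigma>\<^sup>2 / \<epsilon> ^ 4)"
    by (intro mult_left_mono) (simp_all only: real_norm_def abs_ge_self zero_le_power2 zero_le_mult_iff zero_le_numeral simp_thms)
  finally show "norm (real_of_int (\<lceil>\<Delta> * L / \<epsilon>\<^sup>2\<rceil> * \<lceil>(exp 1)\<^sup>2 * ln (real d) * \<sigma>\<^sup>2 / \<epsilon>\<^sup>2\<rceil>))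
      \<le> 4 * (exp 1)\<^sup>2 * norm (\<Delta> * L * ln (real d) * \<sigma>\<^sup>2 / \<epsilon> ^ 4)"
    by (simp only: p_def q_def)
qed

theorem corollary1:
  fixes X :: "(real ^ 'n) set"
    and D :: "'z measure"
    and F :: "real ^ 'n \<Rightarrow> 'z \<Rightarrow> real"
    and f :: "real ^ 'n \<Rightarrow> real"
    and gradf :: "real ^ 'n \<Rightarrow> real ^ 'n"
    and G :: "real ^ 'n \<Rightarrow> 'z \<Rightarrow> real ^ 'n"
    and \<sigma> L flow \<Delta> \<epsilon> \<rho> :: real
    and M :: "'w measure"
    and x :: "nat \<Rightarrow> 'w \<Rightarrow> real ^ 'n"
    and \<zeta> :: "nat \<Rightarrow> nat \<Rightarrow> 'w \<Rightarrow> 'z"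
    and Y :: "'w \<Rightarrow> nat"
    and \<eta> :: "nat \<Rightarrow> real"
    and K :: nat
    and m :: "nat \<Rightarrow> nat"
  assumes X: "closed X" "convex X"
    and D: "prob_space D"
    and F_integrable: "\<And>u. integrable D (F u)"
    and f_def: "\<And>u. f u = (LINT z|D. F u z)"
    and f_grad: "\<And>u. GDERIV f u :> gradf u"
    and G_meas: "(\<lambda>(u, z). G u z) \<in> borel_measurable (restrict_space borel X \<Otimes>\<^sub>M D)"
    and G_unbiased: "\<And>u. u \<in> X \<Longrightarrow> has_bochner_integral D (G u) (gradf u)"
    and variance: "ennreal (\<sigma>\<^sup>2) = (SUP u\<in>X. \<integral>\<^sup>+z. ennreal ((infnorm (G u z - gradf u))\<^sup>2) \<partial>D)"
    and L_nonneg: "0 \<le> L"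
    and smooth: "\<And>u v. u \<in> X \<Longrightarrow> v \<in> X \<Longrightarrow> infnorm (gradf u - gradf v) \<le> L * l1norm (u - v)"
    and bounded_below: "\<And>u. u \<in> X \<Longrightarrow> flow \<le> f u"
    and M: "prob_space M"
    and x1_in: "\<And>\<omega>. \<omega> \<in> space M \<Longrightarrow> x 1 \<omega> \<in> X"
    and x1_integrable: "integrable M (\<lambda>\<omega>. f (x 1 \<omega>))"
    and \<Delta>_def: "\<Delta> = (LINT \<omega>|M. f (x 1 \<omega>)) - flow"
    and \<epsilon>_pos: "0 < \<epsilon>"
    and \<rho>: "3 / 2 < \<rho>"
    and \<eta>_def: "\<And>k. \<eta> k = 1 / L"
    and K_def: "K = nat \<lceil>\<Delta> * L / \<epsilon>\<^sup>2\<rceil>"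
    and m_def: "\<And>k. m k = nat \<lceil>(exp 1)\<^sup>2 * ln (real CARD('n)) * \<sigma>\<^sup>2 / \<epsilon>\<^sup>2\<rceil>"
    and batch_nonempty: "\<And>k. k \<in> {1..K} \<Longrightarrow> 1 \<le> m k"
    and samples_law: "\<And>k i. k \<in> {1..K} \<Longrightarrow> i \<in> {1..m k} \<Longrightarrow> distr M D (\<zeta> k i) = D"
    and samples_indep:
      "prob_space.indep_vars M (\<lambda>_. D) (\<lambda>(k, i). \<zeta> k i) (SIGMA k:{1..K}. {1..m k})"
    and samples_indep_x1:
      "prob_space.indep_rv M borel (x 1)
         (PiM (SIGMA k:{1..K}. {1..m k}) (\<lambda>_. D))
         (\<lambda>\<omega>. \<lambda>(k, i)\<in>(SIGMA k:{1..K}. {1..m k}). \<zeta> k i \<omega>)"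
    and step:
      "\<And>k \<omega>. k \<in> {1..K} \<Longrightarrow> \<omega> \<in> space M \<Longrightarrow>
         prox_step X (\<lambda>u. \<rho> / 2 * (l1norm u)\<^sup>2) (\<eta> k)
           (minibatch G (m k) (x k \<omega>) (\<lambda>i. \<zeta> k i \<omega>)) (x k \<omega>) (x (k + 1) \<omega>)"
    and Y_range: "\<And>\<omega>. \<omega> \<in> space M \<Longrightarrow> Y \<omega> \<in> {1..K}"
    and Y_indep:
      "prob_space.indep_rv M (count_space UNIV) Y
         (PiM {1..K + 1} (\<lambda>_. borel)) (\<lambda>\<omega>. \<lambda>k\<in>{1..K + 1}. x k \<omega>)"
    and Y_law:
      "\<And>k. k \<in> {1..K} \<Longrightarrow> measure M {\<omega> \<in> space M. Y \<omega> = k} = \<eta> k / (\<Sum>j=1..K. \<eta> j)"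
  shows
    "(\<lambda>\<omega>. dist0_inf (frechet_subdiff (\<lambda>u. ereal (f u) + set_ind X u) (x (Y \<omega> + 1) \<omega>)))
        \<in> borel_measurable M
     \<and> (\<integral>\<^sup>+\<omega>. dist0_inf (frechet_subdiff (\<lambda>u. ereal (f u) + set_ind X u) (x (Y \<omega> + 1) \<omega>)) \<partial>M)
        \<le> ennreal (C1 \<rho> * \<epsilon>)
     \<and> int (card (SIGMA k:{1..K}. {1..m k}))
        = \<lceil>\<Delta> * L / \<epsilon>\<^sup>2\<rceil> * \<lceil>(exp 1)\<^sup>2 * ln (real CARD('n)) * \<sigma>\<^sup>2 / \<epsilon>\<^sup>2\<rceil>
     \<and> (\<lambda>(\<Delta>, L, d, \<sigma>, \<epsilon>). real_of_int (\<lceil>\<Delta> * L / \<epsilon>\<^sup>2\<rceil> * \<lceil>(exp 1)\<^sup>2 * ln (real d) * \<sigma>\<^sup>2 / \<epsilon>\<^sup>2\<rceil>))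
        \<in> O[principal {(\<Delta>, L, d :: nat, \<sigma>, \<epsilon>).
               1 \<le> \<Delta> * L / \<epsilon>\<^sup>2 \<and> 1 \<le> (exp 1)\<^sup>2 * ln (real d) * \<sigma>\<^sup>2 / \<epsilon>\<^sup>2}](\<lambda>(\<Delta>, L, d, \<sigma>, \<epsilon>). \<Delta> * L * ln (real d) * \<sigma>\<^sup>2 / \<epsilon> ^ 4)"
proof -
  interpret M: prob_space M by fact

  \<comment> \<open>Consequences of the parameter choices\<close>
  define \<mu> where "\<mu> = m 1"
  have m_eq: "m = (\<lambda>_. \<mu>)" by (rule ext) (simp add: m_def \<mu>_def)
  obtain \<omega>0 where \<omega>0: "\<omega>0 \<in> space M" using M.not_empty by blast
  \<comment> \<open>\<open>Y\<close> needs a value in \<open>{1..K}\<close>, so \<open>K\<close> is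
    positive; \<open>L = 0\<close> would make \<open>K\<close> zero.\<close>
  have K: "1 \<le> K" using Y_range[OF \<omega>0] by simp
  have "L \<noteq> 0"
  proof
    assume "L = 0"
    then have "K = 0" by (simp add: K_def)
    then show False using K by simp
  qed
  then have L: "0 < L" using L_nonneg by simp
  have \<mu>: "1 \<le> \<mu>" using batch_nonempty[of 1] K by (simp add: m_eq)
  define R where "R = (exp 1)\<^sup>2 * ln (real CARD('n)) * \<sigma>\<^sup>2 / \<epsilon>\<^sup>2"
  have \<mu>_R: "\<mu> = nat \<lceil>R\<rceil>" unfolding \<mu>_def R_def by (rule m_def)
  \<comment> \<open>Dimension 1 or zero variance would make the batches empty. This secures what the
    maximal inequality assumes.\<close>
  have "CARD('n) \<noteq> 1"
  proof
    assume "CARD('n) = 1"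
    then have "R = 0" by (simp add: R_def)
    then show False using \<mu> \<mu>_R by simp
  qed
  moreover have "0 < CARD('n)" by simp
  ultimately have d: "2 \<le> CARD('n)" by linarith
  have \<sigma>: "0 < \<sigma>\<^sup>2"
  proof (rule ccontr)
    assume "\<not> 0 < \<sigma>\<^sup>2"
    then have "R = 0" by (simp add: R_def)
    then show False using \<mu> \<mu>_R by simp
  qed
  have \<rho>0: "0 \<le> \<rho>" using \<rho> by simp
  \<comment> \<open>Both numbers are positive, so \<open>nat\<close> has truncated nothing and the
    ceilings are recovered exactly.\<close>
  have K_eq: "int K = \<lceil>\<Delta> * L / \<epsilon>\<^sup>2\<rceil>" using K K_def by linarith
  have \<mu>_eq: "int \<mu> = \<lceil>R\<rceil>" using \<mu> \<mu>_R by linarith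
  have \<Delta>_le: "\<Delta> * L \<le> real K * \<epsilon>\<^sup>2"
  proof -
    have "\<Delta> * L / \<epsilon>\<^sup>2 \<le> real K" using K_eq by linarith
    then show ?thesis using \<epsilon>_pos by (simp add: pos_divide_le_eq)
  qed
  \<comment> \<open>The batch size gives \<open>14 / e\<^sup>2\<close> times
    \<open>\<epsilon>\<^sup>2\<close>; the crude bound \<open>e \<ge> 2\<close> makes the factor
    7/2, rounded up to 4.\<close>
  have var_le: "14 * ln (real CARD('n)) * \<sigma>\<^sup>2 / real \<mu> \<le> 4 * \<epsilon>\<^sup>2"
  proof -
    have ln: "0 \<le> ln (real CARD('n)) * \<sigma>\<^sup>2" using d by simp
    have "2 \<le> exp (1 :: real)" using exp_ge_add_one_self[of 1] by simp
    then have "2\<^sup>2 \<le> (exp (1 :: real))\<^sup>2" by (intro power_mono) auto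
    then have "4 * (ln (real CARD('n)) * \<sigma>\<^sup>2) \<le> (exp 1)\<^sup>2 * (ln (real CARD('n)) * \<sigma>\<^sup>2)"
      using ln by (intro mult_right_mono) auto
    also have "\<dots> = R * \<epsilon>\<^sup>2" using \<epsilon>_pos by (simp add: R_def)
    also have "\<dots> \<le> real \<mu> * \<epsilon>\<^sup>2" using \<mu>_eq by (intro mult_right_mono zero_le_power2) linarith
    finally have "14 * (ln (real CARD('n)) * \<sigma>\<^sup>2) \<le> 4 * (real \<mu> * \<epsilon>\<^sup>2)" using ln by linarith
    then show ?thesis using \<mu> by (simp add: pos_divide_le_eq mult_ac)
  qed
  have cont: "continuous_on X gradf"
    unfolding continuous_on_def
  proof
    fix u assume u: "u \<in> X"
    have b: "((\<lambda>v. sqrt (real CARD('n)) * (L * l1norm (v - u))) \<longlongrightarrow> sqrt (real CARD('n)) * (L * l1norm (u - u))) (at u within X)"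
      by (intro tendsto_intros)
    have "((\<lambda>v. gradf v - gradf u) \<longlongrightarrow> 0) (at u within X)"
    proof (rule Lim_null_comparison)
      show "((\<lambda>v. sqrt (real CARD('n)) * (L * l1norm (v - u))) \<longlongrightarrow> 0) (at u within X)" using b by simp
      show "\<forall>\<^sub>F v in at u within X. norm (gradf v - gradf u) \<le> sqrt (real CARD('n)) * (L * l1norm (v - u))"
        unfolding eventually_at_filter
      proof (intro always_eventually allI impI)
        fix v assume "v \<in> X"
        have "norm (gradf v - gradf u) \<le> sqrt (real CARD('n)) * infnorm (gradf v - gradf u)"
          using norm_le_infnorm[of "gradf v - gradf u"] by simp
        also have "\<dots> \<le> sqrt (real CARD('n)) * (L * l1norm (v - u))"
          by (intro mult_left_mono smooth u \<open>v \<in> X\<close>) simp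
        finally show "norm (gradf v - gradf u) \<le> sqrt (real CARD('n)) * (L * l1norm (v - u))" .
      qed
    qed
    then show "(gradf \<longlongrightarrow> gradf u) (at u within X)" by (simp add: LIM_zero_iff)
  qed
  have var: "(\<integral>\<^sup>+z. ennreal ((infnorm (G u z - gradf u))\<^sup>2) \<partial>D) \<le> ennreal (\<sigma>\<^sup>2)" if "u \<in> X" for u
    unfolding variance using that by (rule SUP_upper)
  define w where "w = (\<lambda>k \<omega>. infnorm (minibatch G \<mu> (x k \<omega>) (\<lambda>i. \<zeta> k i \<omega>) - gradf (x k \<omega>)))"
  note step' = step[unfolded m_eq \<eta>_def]
  have w: "w k \<in> borel_measurable M" "(\<integral>\<^sup>+\<omega>. ennreal ((w k \<omega>)\<^sup>2) \<partial>M) \<le> ennreal (4 * \<epsilon>\<^sup>2)" if k: "k \<in> {1..K}" for k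
  proof -
    note err = nn_integral_gradient_error_le[where \<zeta> = \<zeta> and x = x and K = K and k = k and \<eta> = "1 / L",
        OF X D M cont G_meas G_unbiased var \<rho>0 d \<sigma> \<mu> x1_in samples_law[unfolded m_eq]
          samples_indep[unfolded m_eq] samples_indep_x1[unfolded m_eq] step' k]
    show "w k \<in> borel_measurable M" unfolding w_def by (rule err(1))
    show "(\<integral>\<^sup>+\<omega>. ennreal ((w k \<omega>)\<^sup>2) \<partial>M) \<le> ennreal (4 * \<epsilon>\<^sup>2)"
      unfolding w_def by (rule order_trans[OF err(2) ennreal_leI[OF var_le]])
  qed
  have x_in: "x (Suc k) \<omega> \<in> X" if \<omega>: "\<omega> \<in> space M" and "k \<le> K" for k \<omega>
  proof (cases k)
    case 0
    then show ?thesis using x1_in[OF \<omega>] by simp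
  next
    case (Suc j)
    then show ?thesis using step'[of k \<omega>] \<omega> \<open>k \<le> K\<close> unfolding prox_step_iff by simp
  qed

  \<comment> \<open>Selecting the output by the random index\<close>
  define \<delta> where "\<delta> = (\<lambda>u. dist0_inf (frechet_subdiff (\<lambda>u. ereal (f u) + set_ind X u) u))"
  have \<delta>_meas: "\<delta> \<in> borel_measurable borel"
    unfolding \<delta>_def by (rule borel_measurable_dist0_inf_subdiff[OF X f_grad cont])
  define V where "V = (\<lambda>\<omega>. \<lambda>k\<in>{1..K + 1}. x k \<omega>)"
  \<comment> \<open>The output has index \<open>Y + 1\<close>, which is why the trajectory
    \<open>V\<close> runs up to \<open>K + 1\<close>.\<close>
  define h where "h = (\<lambda>k (v :: nat \<Rightarrow> real ^ 'n). \<delta> (v (k + 1)))"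
  have h_meas: "h k \<in> borel_measurable (PiM {1..K + 1} (\<lambda>_. borel))" if "k \<in> {1..K}" for k
  proof -
    have "k + 1 \<in> {1..K + 1}" using that by auto
    from measurable_compose[OF measurable_component_singleton[OF this, of "\<lambda>_. borel"] \<delta>_meas]
    show ?thesis by (simp add: h_def)
  qed
  have hV: "h k (V \<omega>) = \<delta> (x (k + 1) \<omega>)" if "k \<in> {1..K}" for k \<omega>
    using that by (simp add: h_def V_def)
  have hY: "h (Y \<omega>) (V \<omega>) = \<delta> (x (Y \<omega> + 1) \<omega>)" if "\<omega> \<in> space M" for \<omega>
    by (rule hV[OF Y_range[OF that]])
  have sel: "(\<lambda>\<omega>. h (Y \<omega>) (V \<omega>)) \<in> borel_measurable M"
    "(\<integral>\<^sup>+\<omega>. h (Y \<omega>) (V \<omega>) \<partial>M)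
      = (\<Sum>k=1..K. emeasure M {\<omega> \<in> space M. Y \<omega> = k} * (\<integral>\<^sup>+\<omega>. h k (V \<omega>) \<partial>M))"
    by (rule M.nn_integral_indep_index[where h = h, OF Y_indep[folded V_def] finite_atLeastAtMost]; fact Y_range h_meas)+
  have meas: "(\<lambda>\<omega>. \<delta> (x (Y \<omega> + 1) \<omega>)) \<in> borel_measurable M"
    by (rule measurable_cong[THEN iffD1, OF hY sel(1)])
  have V_meas: "V \<in> measurable M (PiM {1..K + 1} (\<lambda>_. borel))"
    using Y_indep by (simp add: M.indep_rv_def V_def)
  have \<delta>x_meas: "(\<lambda>\<omega>. \<delta> (x (k + 1) \<omega>)) \<in> borel_measurable M" if "k \<in> {1..K}" for k
    using measurable_compose[OF V_meas h_meas[OF that]] by (simp only: hV[OF that])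

  \<comment> \<open>A bound for the sum of the distances along each trajectory\<close>
  define W where "W = (\<lambda>\<omega>. \<Sum>k=1..K. (w k \<omega>)\<^sup>2)"
  \<comment> \<open>The coefficients result from applying \<open>amgm\<close> below to
    \<open>L * D1 k\<close> with weight \<open>\<rho> + 2\<close> and to \<open>w k\<close> with
    weight 1, then eliminating the steps by the telescoped descent. The bound is linear in
    \<open>f (x 1 \<omega>)\<close> and \<open>W \<omega>\<close>, so its expectation is
    immediate.\<close>
  define a where "a = (\<rho> + 2) * L / \<epsilon>"
  define b where "b = (\<rho> + 3) / (2 * \<epsilon>)"
  define c where "c = (\<rho> + 3) * real K * \<epsilon> / 2"
  have abc: "0 \<le> a" "0 \<le> b" "0 \<le> c" using \<rho> L \<epsilon>_pos by (auto simp: a_def b_def c_def)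
  have pointwise: "(\<Sum>k=1..K. \<delta> (x (k + 1) \<omega>)) \<le> ennreal (a * (f (x 1 \<omega>) - flow) + b * W \<omega> + c)"
    if \<omega>: "\<omega> \<in> space M" for \<omega>
  proof -
    define D1 where "D1 = (\<lambda>k. l1norm (x (k + 1) \<omega> - x k \<omega>))"
    have xk: "x k \<omega> \<in> X" if "k \<in> {1..K}" for k
      using that x_in[OF \<omega>, of "k - 1"] by auto
    note bnd = prox_step_bounds[OF X(2) f_grad smooth L \<rho>0 xk step'[OF _ \<omega>]]
    have dist_le: "\<delta> (x (k + 1) \<omega>) \<le> ennreal ((\<rho> + 2) * L * D1 k + w k \<omega>)" if "k \<in> {1..K}" for k
      using bnd(1)[OF _ _ that that] unfolding \<delta>_def D1_def w_def by simp
    have desc: "f (x (k + 1) \<omega>) + (\<rho> - 1) * L * (D1 k)\<^sup>2 \<le> f (x k \<omega>) + (w k \<omega>)\<^sup>2 / (2 * L)" if "k \<in> {1..K}" for k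
      using bnd(2)[OF _ _ that that] unfolding D1_def w_def by simp
    have tele: "n \<le> K \<Longrightarrow> f (x (n + 1) \<omega>) + (\<Sum>k=1..n. (\<rho> - 1) * L * (D1 k)\<^sup>2)
        \<le> f (x 1 \<omega>) + (\<Sum>k=1..n. (w k \<omega>)\<^sup>2 / (2 * L))" for n
    proof (induction n)
      case (Suc n)
      then show ?case using desc[of "Suc n"] by simp
    qed simp
    define Q where "Q = (\<Sum>k=1..K. (D1 k)\<^sup>2)"
    have Q0: "0 \<le> Q" by (simp add: Q_def sum_nonneg)
    have "flow + (\<rho> - 1) * L * Q \<le> f (x 1 \<omega>) + W \<omega> / (2 * L)"
      using tele[of K] bounded_below[OF x_in[OF \<omega>, of K]]
      by (simp add: Q_def W_def sum_distrib_left sum_divide_distrib)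
    \<comment> \<open>Here \<open>3 / 2 < \<rho>\<close> enters: the decrease has a coefficient of
      at least 1/2, independent of \<open>\<rho>\<close>.\<close>
    moreover have "1 / 2 * (L * Q) \<le> (\<rho> - 1) * (L * Q)"
      using \<rho> L Q0 by (intro mult_right_mono) auto
    ultimately have "1 / 2 * (L * Q) \<le> (f (x 1 \<omega>) - flow) + W \<omega> / (2 * L)" by (simp add: mult.assoc)
    then have "2 * L * (1 / 2 * (L * Q)) \<le> 2 * L * ((f (x 1 \<omega>) - flow) + W \<omega> / (2 * L))"
      using L by (intro mult_left_mono) auto
    also have "\<dots> = 2 * L * (f (x 1 \<omega>) - flow) + W \<omega>" using L by (simp add: distrib_left)
    finally have Q: "L\<^sup>2 * Q \<le> 2 * L * (f (x 1 \<omega>) - flow) + W \<omega>" by (simp add: power2_eq_square mult_ac)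
    \<comment> \<open>Trades first powers for squares at scale \<open>\<epsilon>\<close>. On average
      the squares are of order \<open>\<epsilon>\<^sup>2\<close>, so both terms are of order
      \<open>\<epsilon>\<close>, and no Jensen or Cauchy-Schwarz inequality for expectations is
      called for.\<close>
    have amgm: "t \<le> 1 / (2 * \<epsilon>) * t\<^sup>2 + \<epsilon> / 2" for t :: real
    proof -
      have "0 \<le> (t - \<epsilon>)\<^sup>2 / (2 * \<epsilon>)" using \<epsilon>_pos by simp
      also have "\<dots> = 1 / (2 * \<epsilon>) * t\<^sup>2 + \<epsilon> / 2 - t"
        using \<epsilon>_pos by (simp add: power2_eq_square field_simps)
      finally show ?thesis by simp
    qed
    have nonneg: "0 \<le> (\<rho> + 2) * L * D1 k + w k \<omega>" for k
      unfolding D1_def w_def using \<rho> L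
      by (intro add_nonneg_nonneg mult_nonneg_nonneg l1norm_nonneg infnorm_pos_le) auto
    have "(\<Sum>k=1..K. \<delta> (x (k + 1) \<omega>)) \<le> (\<Sum>k=1..K. ennreal ((\<rho> + 2) * L * D1 k + w k \<omega>))"
      by (intro sum_mono dist_le)
    also have "\<dots> = ennreal (\<Sum>k=1..K. (\<rho> + 2) * L * D1 k + w k \<omega>)"
      using nonneg by (intro sum_ennreal)
    also have "\<dots> \<le> ennreal (a * (f (x 1 \<omega>) - flow) + b * W \<omega> + c)"
    proof (rule ennreal_leI)
      have "(\<Sum>k=1..K. (\<rho> + 2) * L * D1 k + w k \<omega>)
        \<le> (\<Sum>k=1..K. (\<rho> + 2) * (1 / (2 * \<epsilon>) * (L * D1 k)\<^sup>2 + \<epsilon> / 2) + (1 / (2 * \<epsilon>) * (w k \<omega>)\<^sup>2 + \<epsilon> / 2))"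
      proof (rule sum_mono)
        fix k
        have "(\<rho> + 2) * (L * D1 k) \<le> (\<rho> + 2) * (1 / (2 * \<epsilon>) * (L * D1 k)\<^sup>2 + \<epsilon> / 2)"
          using \<rho> by (intro mult_left_mono amgm) auto
        with amgm[of "w k \<omega>"] show "(\<rho> + 2) * L * D1 k + w k \<omega>
          \<le> (\<rho> + 2) * (1 / (2 * \<epsilon>) * (L * D1 k)\<^sup>2 + \<epsilon> / 2) + (1 / (2 * \<epsilon>) * (w k \<omega>)\<^sup>2 + \<epsilon> / 2)"
          by (simp only: mult.assoc)
      qed
      also have "\<dots> = (\<rho> + 2) / (2 * \<epsilon>) * (L\<^sup>2 * Q) + 1 / (2 * \<epsilon>) * W \<omega> + c"
      proof -
        have "(\<Sum>k=1..K. (\<rho> + 2) * (1 / (2 * \<epsilon>) * (L * D1 k)\<^sup>2 + \<epsilon> / 2) + (1 / (2 * \<epsilon>) * (w k \<omega>)\<^sup>2 + \<epsilon> / 2))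
          = (\<Sum>k=1..K. ((\<rho> + 2) / (2 * \<epsilon>) * L\<^sup>2) * (D1 k)\<^sup>2 + 1 / (2 * \<epsilon>) * (w k \<omega>)\<^sup>2 + (\<rho> + 3) * \<epsilon> / 2)"
          by (intro sum.cong refl) (simp add: power_mult_distrib algebra_simps)
        also have "\<dots> = ((\<rho> + 2) / (2 * \<epsilon>) * L\<^sup>2) * Q + 1 / (2 * \<epsilon>) * W \<omega> + real K * ((\<rho> + 3) * \<epsilon> / 2)"
          unfolding sum.distrib Q_def W_def sum_distrib_left[symmetric] by simp
        finally show ?thesis by (simp add: c_def mult_ac)
      qed
      also have "\<dots> \<le> (\<rho> + 2) / (2 * \<epsilon>) * (2 * L * (f (x 1 \<omega>) - flow) + W \<omega>) + 1 / (2 * \<epsilon>) * W \<omega> + c"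
        using \<rho> \<epsilon>_pos by (intro add_right_mono mult_left_mono Q) auto
      also have "\<dots> = a * (f (x 1 \<omega>) - flow) + b * W \<omega> + c"
        using \<epsilon>_pos by (simp add: a_def b_def field_simps)
      finally show "(\<Sum>k=1..K. (\<rho> + 2) * L * D1 k + w k \<omega>) \<le> a * (f (x 1 \<omega>) - flow) + b * W \<omega> + c" .
    qed
    finally show ?thesis .
  qed

  \<comment> \<open>Passing to expectations\<close>
  have W_meas: "W \<in> borel_measurable M"
    unfolding W_def by (intro borel_measurable_sum borel_measurable_power w(1))
  have f1_int: "integrable M (\<lambda>\<omega>. a * (f (x 1 \<omega>) - flow))" using x1_integrable by simp
  have f1_nonneg: "0 \<le> a * (f (x 1 \<omega>) - flow)" if "\<omega> \<in> space M" for \<omega>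
    using abc(1) bounded_below[OF x1_in[OF that]] by simp
  have W_nonneg: "0 \<le> W \<omega>" for \<omega> by (simp add: W_def sum_nonneg)
  have "(\<Sum>k=1..K. \<integral>\<^sup>+\<omega>. \<delta> (x (k + 1) \<omega>) \<partial>M) = (\<integral>\<^sup>+\<omega>. (\<Sum>k=1..K. \<delta> (x (k + 1) \<omega>)) \<partial>M)"
    by (rule nn_integral_sum[symmetric]) (rule \<delta>x_meas)
  also have "\<dots> \<le> (\<integral>\<^sup>+\<omega>. ennreal (a * (f (x 1 \<omega>) - flow)) + ennreal b * ennreal (W \<omega>) + ennreal c \<partial>M)"
  proof (rule nn_integral_mono)
    fix \<omega> assume \<omega>: "\<omega> \<in> space M"
    have "ennreal (a * (f (x 1 \<omega>) - flow) + b * W \<omega> + c)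
      = ennreal (a * (f (x 1 \<omega>) - flow)) + ennreal b * ennreal (W \<omega>) + ennreal c"
      using f1_nonneg[OF \<omega>] W_nonneg[of \<omega>] abc by (simp add: ennreal_plus ennreal_mult)
    with pointwise[OF \<omega>] show "(\<Sum>k=1..K. \<delta> (x (k + 1) \<omega>))
      \<le> ennreal (a * (f (x 1 \<omega>) - flow)) + ennreal b * ennreal (W \<omega>) + ennreal c" by simp
  qed
  also have "\<dots> = (\<integral>\<^sup>+\<omega>. ennreal (a * (f (x 1 \<omega>) - flow)) \<partial>M) + ennreal b * (\<integral>\<^sup>+\<omega>. ennreal (W \<omega>) \<partial>M) + ennreal c"
    using W_meas borel_measurable_integrable[OF f1_int]
    by (simp add: nn_integral_add nn_integral_cmult M.emeasure_space_1)
  also have "(\<integral>\<^sup>+\<omega>. ennreal (a * (f (x 1 \<omega>) - flow)) \<partial>M) = ennreal (a * \<Delta>)"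
    using nn_integral_eq_integral[OF f1_int] f1_nonneg x1_integrable
    by (simp add: \<Delta>_def M.prob_space)
  also have "(\<integral>\<^sup>+\<omega>. ennreal (W \<omega>) \<partial>M) \<le> ennreal (real K * (4 * \<epsilon>\<^sup>2))"
  proof -
    have "(\<integral>\<^sup>+\<omega>. ennreal (W \<omega>) \<partial>M) = (\<integral>\<^sup>+\<omega>. (\<Sum>k=1..K. ennreal ((w k \<omega>)\<^sup>2)) \<partial>M)"
      by (simp add: W_def sum_ennreal)
    also have "\<dots> = (\<Sum>k=1..K. \<integral>\<^sup>+\<omega>. ennreal ((w k \<omega>)\<^sup>2) \<partial>M)"
      by (intro nn_integral_sum measurable_compose[OF _ measurable_ennreal] borel_measurable_power w(1))
    also have "\<dots> \<le> (\<Sum>k=1..K. ennreal (4 * \<epsilon>\<^sup>2))" by (intro sum_mono w(2))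
    also have "\<dots> = ennreal (real K * (4 * \<epsilon>\<^sup>2))"
      by (simp add: ennreal_mult ennreal_of_nat_eq_real_of_nat)
    finally show ?thesis .
  qed
  finally have total: "(\<Sum>k=1..K. \<integral>\<^sup>+\<omega>. \<delta> (x (k + 1) \<omega>) \<partial>M)
      \<le> ennreal (a * \<Delta>) + ennreal b * ennreal (real K * (4 * \<epsilon>\<^sup>2)) + ennreal c"
    by (simp add: add_mono mult_left_mono)

  \<comment> \<open>Averaging over the index, which is uniform since the stepsizes are
    constant\<close>
  have prob_Y: "emeasure M {\<omega> \<in> space M. Y \<omega> = k} = ennreal (1 / real K)" if "k \<in> {1..K}" for k
    using Y_law[OF that] L K by (simp add: M.emeasure_eq_measure \<eta>_def)
  have "(\<integral>\<^sup>+\<omega>. \<delta> (x (Y \<omega> + 1) \<omega>) \<partial>M) = (\<integral>\<^sup>+\<omega>. h (Y \<omega>) (V \<omega>) \<partial>M)"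
    by (rule nn_integral_cong) (simp only: hY)
  also have "\<dots> = (\<Sum>k=1..K. ennreal (1 / real K) * (\<integral>\<^sup>+\<omega>. \<delta> (x (k + 1) \<omega>) \<partial>M))"
    unfolding sel(2) by (intro sum.cong refl) (simp only: prob_Y hV)
  also have "\<dots> = ennreal (1 / real K) * (\<Sum>k=1..K. \<integral>\<^sup>+\<omega>. \<delta> (x (k + 1) \<omega>) \<partial>M)"
    by (simp only: sum_distrib_left)
  also have "\<dots> \<le> ennreal (1 / real K) * (ennreal (a * \<Delta>) + ennreal b * ennreal (real K * (4 * \<epsilon>\<^sup>2)) + ennreal c)"
    by (intro mult_left_mono total) simp
  also have "\<dots> \<le> ennreal (C1 \<rho> * \<epsilon>)"
  proof -
    have a\<Delta>: "a * \<Delta> \<le> (\<rho> + 2) / \<epsilon> * (real K * \<epsilon>\<^sup>2)"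
    proof -
      have "a * \<Delta> = (\<rho> + 2) / \<epsilon> * (\<Delta> * L)" by (simp add: a_def)
      also have "\<dots> \<le> (\<rho> + 2) / \<epsilon> * (real K * \<epsilon>\<^sup>2)"
        using \<rho> \<epsilon>_pos by (intro mult_left_mono \<Delta>_le) auto
      finally show ?thesis .
    qed
    have "ennreal (a * \<Delta>) + ennreal b * ennreal (real K * (4 * \<epsilon>\<^sup>2)) + ennreal c
      \<le> ennreal ((\<rho> + 2) / \<epsilon> * (real K * \<epsilon>\<^sup>2)) + ennreal b * ennreal (real K * (4 * \<epsilon>\<^sup>2)) + ennreal c"
      using a\<Delta> by (intro add_mono ennreal_leI) auto
    also have "\<dots> = ennreal ((\<rho> + 2) / \<epsilon> * (real K * \<epsilon>\<^sup>2) + b * (real K * (4 * \<epsilon>\<^sup>2)) + c)"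
      using abc \<rho> \<epsilon>_pos by (simp add: ennreal_plus ennreal_mult)
    \<comment> \<open>Per iteration and in units of \<open>\<epsilon>\<close>, the initial gap
      contributes \<open>\<rho> + 2\<close>, the gradient errors \<open>2 * (\<rho> + 3)\<close> and
      the constant term \<open>(\<rho> + 3) / 2\<close>; their sum lies below
      \<open>C1 \<rho>\<close>.\<close>
    also have "(\<rho> + 2) / \<epsilon> * (real K * \<epsilon>\<^sup>2) + b * (real K * (4 * \<epsilon>\<^sup>2)) + c = real K * ((7 / 2 * \<rho> + 19 / 2) * \<epsilon>)"
      using \<epsilon>_pos by (simp add: b_def c_def power2_eq_square field_simps)
    finally have "ennreal (1 / real K) * (ennreal (a * \<Delta>) + ennreal b * ennreal (real K * (4 * \<epsilon>\<^sup>2)) + ennreal c)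
      \<le> ennreal (1 / real K) * ennreal (real K * ((7 / 2 * \<rho> + 19 / 2) * \<epsilon>))"
      by (intro mult_left_mono) auto
    also have "\<dots> = ennreal ((7 / 2 * \<rho> + 19 / 2) * \<epsilon>)"
      using K by (subst ennreal_mult'[symmetric]) auto
    also have "\<dots> \<le> ennreal (C1 \<rho> * \<epsilon>)"
      using \<rho> \<epsilon>_pos by (intro ennreal_leI mult_right_mono) (auto simp: C1_def)
    finally show ?thesis .
  qed
  finally have bound: "(\<integral>\<^sup>+\<omega>. \<delta> (x (Y \<omega> + 1) \<omega>) \<partial>M) \<le> ennreal (C1 \<rho> * \<epsilon>)" .

  have card: "int (card (SIGMA k:{1..K}. {1..m k})) = \<lceil>\<Delta> * L / \<epsilon>\<^sup>2\<rceil> * \<lceil>R\<rceil>"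
    by (simp add: m_eq card_cartesian_product K_eq[symmetric] \<mu>_eq[symmetric])
  show ?thesis
    using meas bound card sample_complexity_bigo unfolding \<delta>_def R_def by blast
qed

end
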